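(* Let $$\Phi(R,v_1,v_2,v_3)=\alpha(R)\sum_{i}\phi(v_i)+\beta(R)\sum_{i<j}\psi(v_iv_j)+\gamma(R)h(v_1v_2v_3),$$ where $\alpha,\beta,\gamma$ are smooth positive functions on $[0,1]$, $\phi$ and $\psi$ are nonnegative convex functions and $h$ is strictly convex. Let $\lambda>0$ and let $r\in\mathcal{A}_\lambda$ satisfy $r(0)=0$ and $$\lim_{R\to0^+}r'(R)=\ell\quad\text{with }\ell\in(0,\infty].$$ If $\ell>\lambda_c^h$, then $r$ cannot be a minimizer of $I$ over $\mathcal{A}_\lambda$.
   Context: The reference mass density $\rho_0:[0,1]\to\mathbb{R}$ satisfies $k_0\le\rho_0(R)\le k_1$ for $0\le R\le 1$, with positive constants $k_0,k_1$, and $M_R=4\pi\int_0^R\rho_0(u)u^2\,du$. Define $$I(r)=I_{\rm mec}(r)-I_{\rm pot}(r),\quad I_{\rm mec}(r)=\int_0^1\Phi\left(R,r'(R),\tfrac{r(R)}{R},\tfrac{r(R)}{R}\right)R^2\,dR,\quad I_{\rm pot}(r)=\int_0^1\rho_0(R)\frac{M_R}{r(R)}R^2\,dR,$$ and, for $\lambda>0$, $$\mathcal{A}_\lambda=\{r\in W^{1,1}(0,1): r(1)=\lambda,\ r'(R)>0\text{ for a.e. }R\in(0,1),\ r(0)\ge0,\ I_{\rm mec}(r)<\infty\}.$$ Standing assumption: $\Phi(R,v_1,v_2,v_3)\ge\hat\phi(v_1)+\hat\phi(v_2)+\hat\phi(v_3)+\hat h(v_1v_2v_3)$ for all $R\in[0,1]$,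 $v_i>0$, for some strictly convex $\hat\phi,\hat h:(0,\infty)\to(0,\infty)$ with $\hat\phi(v)\ge Cv^{q}$ for some $C>0$ and $1<q<3$; $\hat h(d)/d\to\infty$ as $d\to\infty$; and $\hat h(d)\ge Kd^{-s}$ for all $d>0$, for some $K>0$ and $s\ge\frac{q}{q-1}$. $\lambda_c^h$ denotes the critical boundary displacement of the (Ball) radial cavitation problem without gravity for the homogeneous stored energy function $\Phi(0,v_1,v_2,v_3)$. That is, let $E(r)=\int_0^1\Phi\left(0,r'(R),\frac{r(R)}{R},\frac{r(R)}{R}\right)R^2\,dR$ and $\mathcal{A}^0_\mu=\{r\in W^{1,1}(0,1): r(1)=\mu,\ r'>0\text{ a.e.},\ r(0)\ge0,\ E(r)<\infty\}$; then $\lambda_c^h$ is the number such that for $0<\mu\le\lambda_c^h$ the map $R\mapsto\mu R$ is the unique minimizer of $E$ over $\mathcal{A}^0_\mu$, while for $\mu>\lambda_c^h$ every minimizer $r$ of $E$ over $\mathcal{A}^0_\mu$ satisfies $r(0)>0$. *)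

theory Defs
  imports "HOL-Analysis.Analysis"
begin

section \<open>The Sobolev space of radial maps\<close>

text \<open>Test functions on \<open>(0,1)\<close>: continuously differentiable with compact support.\<close>

definition test_fun :: "(real \<Rightarrow> real) \<Rightarrow> bool" where
  "test_fun \<eta> \<longleftrightarrow> \<eta> C1_differentiable_on UNIV \<and> closure {x. \<eta> x \<noteq> 0} \<subseteq> {0<..<1}"

definition has_weak_deriv :: "(real \<Rightarrow> real) \<Rightarrow> (real \<Rightarrow> real) \<Rightarrow> bool" where
  "has_weak_deriv r g \<longleftrightarrow>
     set_integrable lebesgue {0<..<1} g \<and>
     (\<forall>\<eta>. test_fun \<eta> \<longrightarrow>
        (LINT x:{0<..<1}|lebesgue. r x * deriv \<eta> x) = - (LINT x:{0<..<1}|lebesgue. g x * \<eta> x))"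

text \<open>Every class in \<open>W\<^sup>1\<^sup>,\<^sup>1(0,1)\<close> has exactly one representative that is
  continuous on \<open>[0,1]\<close>. The elements below are these representatives, so that the boundary
  values \<open>r(0)\<close> and \<open>r(1)\<close> are point values; values outside \<open>[0,1]\<close> play no role.\<close>

definition W11 :: "(real \<Rightarrow> real) set" where
  "W11 = {r. continuous_on {0..1} r \<and> (\<exists>g. has_weak_deriv r g)}"

text \<open>The choice only fixes the weak derivative up to null sets; it is used below solely under
  integrals and almost-everywhere quantifiers.\<close>

definition weak_deriv :: "(real \<Rightarrow> real) \<Rightarrow> real \<Rightarrow> real" where
  "weak_deriv r = (SOME g. has_weak_deriv r g)"


section \<open>Energies and admissible maps\<close>

text \<open>The mechanical energy has values in \<open>[0,\<infinity>]\<close>: the stored energies considered are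
  nonnegative at positive arguments, by \<open>energy_growth\<close> below, and \<open>ennreal\<close> truncates nothing.\<close>

definition I_mec :: "(real \<Rightarrow> real \<Rightarrow> real \<Rightarrow> real \<Rightarrow> real) \<Rightarrow> (real \<Rightarrow> real) \<Rightarrow> ennreal" where
  "I_mec \<Phi> r =
     (\<integral>\<^sup>+R\<in>{0<..<1}. ennreal (\<Phi> R (weak_deriv r R) (r R / R) (r R / R) * R\<^sup>2) \<partial>lebesgue)"

definition mass_in :: "(real \<Rightarrow> real) \<Rightarrow> real \<Rightarrow> real" where
  "mass_in \<rho>\<^sub>0 R = 4 * pi * (LINT u:{0..R}|lebesgue. \<rho>\<^sub>0 u * u\<^sup>2)"

definition I_pot :: "(real \<Rightarrow> real) \<Rightarrow> (real \<Rightarrow> real) \<Rightarrow> ennreal" where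
  "I_pot \<rho>\<^sub>0 r =
     (\<integral>\<^sup>+R\<in>{0<..<1}. ennreal (\<rho>\<^sub>0 R * (mass_in \<rho>\<^sub>0 R / r R) * R\<^sup>2) \<partial>lebesgue)"

text \<open>On admissible maps the first term is finite, so the difference is never of the form
  \<open>\<infinity> - \<infinity>\<close>.\<close>

definition I_total ::
  "(real \<Rightarrow> real) \<Rightarrow> (real \<Rightarrow> real \<Rightarrow> real \<Rightarrow> real \<Rightarrow> real) \<Rightarrow> (real \<Rightarrow> real) \<Rightarrow> ereal" where
  "I_total \<rho>\<^sub>0 \<Phi> r = enn2ereal (I_mec \<Phi> r) - enn2ereal (I_pot \<rho>\<^sub>0 r)"

definition admissible ::
  "(real \<Rightarrow> real \<Rightarrow> real \<Rightarrow> real \<Rightarrow> real) \<Rightarrow> real \<Rightarrow> (real \<Rightarrow> real) set" where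
  "admissible \<Phi> lam =
     {r \<in> W11. r 1 = lam \<and> (AE R in lebesgue. R \<in> {0<..<1} \<longrightarrow> weak_deriv r R > 0) \<and>
        r 0 \<ge> 0 \<and> I_mec \<Phi> r < \<infinity>}"

text \<open>The problem without gravity for the stored energy frozen at \<open>R = 0\<close>.\<close>

definition E_hom :: "(real \<Rightarrow> real \<Rightarrow> real \<Rightarrow> real \<Rightarrow> real) \<Rightarrow> (real \<Rightarrow> real) \<Rightarrow> ennreal" where
  "E_hom \<Phi> = I_mec (\<lambda>_. \<Phi> 0)"

definition admissible_hom ::
  "(real \<Rightarrow> real \<Rightarrow> real \<Rightarrow> real \<Rightarrow> real) \<Rightarrow> real \<Rightarrow> (real \<Rightarrow> real) set" where
  "admissible_hom \<Phi> \<mu> = admissible (\<lambda>_. \<Phi> 0) \<mu>"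

definition critical_displacement ::
  "(real \<Rightarrow> real \<Rightarrow> real \<Rightarrow> real \<Rightarrow> real) \<Rightarrow> real \<Rightarrow> bool" where
  "critical_displacement \<Phi> lam\<^sub>c \<longleftrightarrow>
     (\<forall>\<mu>. 0 < \<mu> \<and> \<mu> \<le> lam\<^sub>c \<longrightarrow>
        is_arg_min (E_hom \<Phi>) (\<lambda>s. s \<in> admissible_hom \<Phi> \<mu>) (\<lambda>R. \<mu> * R) \<and>
        (\<forall>s. is_arg_min (E_hom \<Phi>) (\<lambda>s. s \<in> admissible_hom \<Phi> \<mu>) s \<longrightarrow>
           (\<forall>R\<in>{0..1}. s R = \<mu> * R))) \<and>
     (\<forall>\<mu>. 0 < \<mu> \<and> lam\<^sub>c < \<mu> \<longrightarrow>
        (\<forall>s. is_arg_min (E_hom \<Phi>) (\<lambda>s. s \<in> admissible_hom \<Phi> \<mu>) s \<longrightarrow> s 0 > 0))"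


section \<open>Stored energy functions\<close>

definition strictly_convex_on :: "real set \<Rightarrow> (real \<Rightarrow> real) \<Rightarrow> bool" where
  "strictly_convex_on S f \<longleftrightarrow>
     convex S \<and>
     (\<forall>x\<in>S. \<forall>y\<in>S. x \<noteq> y \<longrightarrow>
        (\<forall>t\<in>{0<..<1}. f ((1 - t) * x + t * y) < (1 - t) * f x + t * f y))"

definition energy_growth :: "(real \<Rightarrow> real \<Rightarrow> real \<Rightarrow> real \<Rightarrow> real) \<Rightarrow> bool" where
  "energy_growth \<Phi> \<longleftrightarrow>
     (\<exists>\<phi>' h' C q K s.
        strictly_convex_on {0<..} \<phi>' \<and> (\<forall>v>0. \<phi>' v > 0) \<and>
        strictly_convex_on {0<..} h' \<and> (\<forall>d>0. h' d > 0) \<and>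
        (\<forall>R\<in>{0..1}. \<forall>v1>0. \<forall>v2>0. \<forall>v3>0.
           \<Phi> R v1 v2 v3 \<ge> \<phi>' v1 + \<phi>' v2 + \<phi>' v3 + h' (v1 * v2 * v3)) \<and>
        C > 0 \<and> 1 < q \<and> q < 3 \<and> (\<forall>v>0. \<phi>' v \<ge> C * v powr q) \<and>
        filterlim (\<lambda>d. h' d / d) at_top at_top \<and>
        K > 0 \<and> s \<ge> q / (q - 1) \<and> (\<forall>d>0. h' d \<ge> K * d powr (- s)))"

text \<open>Infinitely differentiable on \<open>[0,1]\<close>, with one-sided derivatives at the endpoints.\<close>

definition smooth_on_unit :: "(real \<Rightarrow> real) \<Rightarrow> bool" where
  "smooth_on_unit f \<longleftrightarrow>
     (\<exists>D :: nat \<Rightarrow> real \<Rightarrow> real. D 0 = f \<and>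
        (\<forall>n. \<forall>x\<in>{0..1}. (D n has_real_derivative D (Suc n) x) (at x within {0..1})))"

definition stored_energy ::
  "(real \<Rightarrow> real) \<Rightarrow> (real \<Rightarrow> real) \<Rightarrow> (real \<Rightarrow> real) \<Rightarrow> (real \<Rightarrow> real) \<Rightarrow> (real \<Rightarrow> real) \<Rightarrow> (real \<Rightarrow> real) \<Rightarrow>
   real \<Rightarrow> real \<Rightarrow> real \<Rightarrow> real \<Rightarrow> real" where
  "stored_energy \<alpha> \<beta> \<gamma> \<phi> \<psi> h R v1 v2 v3 =
     \<alpha> R * (\<phi> v1 + \<phi> v2 + \<phi> v3) +
     \<beta> R * (\<psi> (v1 * v2) + \<psi> (v1 * v3) + \<psi> (v2 * v3)) +
     \<gamma> R * h (v1 * v2 * v3)"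

end

theory Submission
  imports Defs
begin

text \<open>Any map without a cavity has at least the frozen energy of the homogeneous map with the same
  boundary value (Jensen, via the null Lagrangians \<open>R\<^sup>2 s\<close>, \<open>R s\<^sup>2\<close>, \<open>s\<^sup>3\<close>). Beyond the critical
  displacement some \<open>s\<close> does strictly better, hence \<open>s 0 > 0\<close>, so \<open>s d / d\<close> takes every value
  \<open>\<ge> s 1\<close>. Near the origin replace \<open>r\<close> on \<open>[0,e]\<close> by \<open>(e / d) s(d x / e)\<close>, with \<open>d\<close> chosen
  such that \<open>s d / d = r e / e\<close>. The mechanical energy drops by at least a constant times \<open>e\<^sup>3\<close>: for
  bounded \<open>r e / e\<close> the gain is the energy gap of \<open>s\<close>, for \<open>r e / e \<rightarrow> \<infinity>\<close> it comes from the superlinear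
  growth in the determinant. The potential energy changes unfavourably by at most \<open>O(e\<^sup>5)\<close>, since
  \<open>r\<close> grows at least linearly.\<close>

section \<open>Indefinite integrals\<close>

text \<open>The rescaling in the competitor preserves all three stretches, so frozen energies scale
  by \<open>(e / d)^3\<close>, and gains and losses are compared at order \<open>e^3\<close>. The
  obstacle is that \<open>r e / e\<close> varies with \<open>e\<close> and is only known to lie
  eventually above the value \<open>s 1\<close> at which \<open>s\<close> beats the homogeneous map.
  The cavity of \<open>s\<close> answers this: every larger slope is attained as
  \<open>s d / d\<close>, and the energy gap of \<open>s\<close> is fully retained on
  \<open>{0..d}\<close>. Since \<open>d <= 1\<close>, rescaling keeps at least \<open>e^3\<close>
  times that gap. The dependence of \<Phi> on \<open>R\<close> costs a small multiple of
  \<open>\<Phi> 0 + 1\<close>, which the gap absorbs only while the slopes stay bounded; this is why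
  blow-up is treated separately. For gravity, a mass of order \<open>R^3\<close> over
  \<open>r R >= c * R\<close> with the weight \<open>R^2\<close> gives an integrand of order
  \<open>R^4\<close>, hence the exponent 5. Working with densities that are positive everywhere,
  instead of weak derivatives chosen up to null sets, keeps the energy estimates pointwise.\<close>

definition primitive_on :: "real \<Rightarrow> real \<Rightarrow> (real \<Rightarrow> real) \<Rightarrow> (real \<Rightarrow> real) \<Rightarrow> bool" where
  "primitive_on a b u g \<longleftrightarrow>
     g absolutely_integrable_on {a..b} \<and>
     (\<forall>x\<in>{a..b}. \<forall>y\<in>{a..b}. x \<le> y \<longrightarrow> (g has_integral (u y - u x)) {x..y})"

lemma primitive_on_abs_integrable: "primitive_on a b u g \<Longrightarrow> g absolutely_integrable_on {a..b}"
  by (simp add: primitive_on_def)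

lemma primitive_on_has_integral:
  "primitive_on a b u g \<Longrightarrow> a \<le> x \<Longrightarrow> x \<le> y \<Longrightarrow> y \<le> b \<Longrightarrow> (g has_integral (u y - u x)) {x..y}"
  by (auto simp: primitive_on_def)

lemma primitive_onI:
  assumes "g absolutely_integrable_on {a..b}"
    and "\<And>x. a \<le> x \<Longrightarrow> x \<le> b \<Longrightarrow> (g has_integral (u x - u a)) {a..x}"
  shows "primitive_on a b u g"
  unfolding primitive_on_def
proof (intro conjI ballI impI assms(1))
  fix x y assume xy: "x \<in> {a..b}" "y \<in> {a..b}" "x \<le> y"
  have gi: "g integrable_on {x..y}"
    using assms(1) xy by (auto intro!: integrable_on_subinterval[OF set_lebesgue_integral_eq_integral(1)])
  have "integral {a..x} g + integral {x..y} g = integral {a..y} g"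
    using xy assms(2)[of y] by (intro Henstock_Kurzweil_Integration.integral_combine) auto
  then have "integral {x..y} g = u y - u x"
    using assms(2)[of x] assms(2)[of y] xy by (auto simp: has_integral_iff)
  then show "(g has_integral (u y - u x)) {x..y}"
    using gi by (simp add: has_integral_iff)
qed

lemma primitive_on_subset:
  assumes "primitive_on a b u g" "a \<le> c" "d \<le> b"
  shows "primitive_on c d u g"
proof -
  have "g absolutely_integrable_on {c..d}"
    using assms by (intro absolutely_integrable_on_subinterval[OF primitive_on_abs_integrable]) auto
  then show ?thesis using assms unfolding primitive_on_def by auto
qed

lemma primitive_on_continuous:
  assumes "primitive_on a b u g"
  shows "continuous_on {a..b} u"
proof -
  have "g integrable_on {a..b}"
    using assms by (auto simp: primitive_on_def absolutely_integrable_on_def)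
  then have "continuous_on {a..b} (\<lambda>x. u a + integral {a..x} g)"
    by (intro continuous_intros indefinite_integral_continuous_1)
  then show ?thesis
  proof (rule continuous_on_eq)
    show "u a + integral {a..x} g = u x" if "x \<in> {a..b}" for x
      using primitive_on_has_integral[OF assms, of a x] that by (auto simp: has_integral_iff)
  qed
qed

lemma primitive_on_C1:
  assumes "\<And>x. x \<in> {a..b} \<Longrightarrow> (u has_real_derivative g x) (at x within {a..b})"
    and "continuous_on {a..b} g"
  shows "primitive_on a b u g"
proof (rule primitive_onI)
  show "g absolutely_integrable_on {a..b}"
    using assms(2) absolutely_integrable_continuous_real by blast
  show "(g has_integral (u x - u a)) {a..x}" if "a \<le> x" "x \<le> b" for x
  proof (rule fundamental_theorem_of_calculus)
    show "(u has_vector_derivative g y) (at y within {a..x})" if "y \<in> {a..x}" for y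
      using assms(1)[of y] that \<open>x \<le> b\<close>
      by (auto simp flip: has_real_derivative_iff_has_vector_derivative intro: DERIV_subset)
  qed (use that in auto)
qed

lemma primitive_on_add:
  assumes "primitive_on a b u g" "primitive_on a b v k"
  shows "primitive_on a b (\<lambda>x. u x + v x) (\<lambda>x. g x + k x)"
  unfolding primitive_on_def
proof (intro conjI ballI impI)
  show "(\<lambda>x. g x + k x) absolutely_integrable_on {a..b}"
    using assms by (intro set_integral_add) (auto dest: primitive_on_abs_integrable)
  show "((\<lambda>x. g x + k x) has_integral u y + v y - (u x + v x)) {x..y}"
    if "x \<in> {a..b}" "y \<in> {a..b}" "x \<le> y" for x y
    using has_integral_add[of g "u y - u x" "{x..y}" k "v y - v x"] assms that
    by (auto simp: primitive_on_def algebra_simps)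
qed

lemma primitive_on_cmult:
  assumes "primitive_on a b u g"
  shows "primitive_on a b (\<lambda>x. c * u x) (\<lambda>x. c * g x)"
  unfolding primitive_on_def
proof (intro conjI ballI impI)
  show "(\<lambda>x. c * g x) absolutely_integrable_on {a..b}"
    using assms by (intro set_integrable_mult_right) (auto dest: primitive_on_abs_integrable)
  show "((\<lambda>x. c * g x) has_integral c * u y - c * u x) {x..y}"
    if "x \<in> {a..b}" "y \<in> {a..b}" "x \<le> y" for x y
    using has_integral_mult_right[of g "u y - u x" "{x..y}" c] assms that
    by (auto simp: primitive_on_def algebra_simps)
qed

section \<open>Product rule for absolutely continuous functions\<close>

lemma local_increment_bound_imp_global:
  fixes D G :: "real \<Rightarrow> real"
  assumes "d > 0"
    and loc: "\<And>x y. a \<le> x \<Longrightarrow> x \<le> y \<Longrightarrow> y \<le> b \<Longrightarrow> y - x < d \<Longrightarrow> \<bar>D y - D x\<bar> \<le> e * (G y - G x)"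
    and "a \<le> b"
  shows "\<bar>D b - D a\<bar> \<le> e * (G b - G a)"
proof -
  \<comment> \<open>The right-hand side telescopes, so the local bounds can be chained; the
    induction counts the pieces of length below \<open>d\<close>.\<close>
  have *: "\<bar>D y - D a\<bar> \<le> e * (G y - G a)" if "a \<le> y" "y \<le> b" "y - a < real n * d" for n y
    using that
  proof (induction n arbitrary: y)
    case 0
    then show ?case by simp
  next
    case (Suc n)
    show ?case
    proof (cases "y - a < d")
      case True
      then show ?thesis using loc[of a y] Suc.prems by simp
    next
      case False
      \<comment> \<open>Cuts off the last of \<open>n + 1\<close> equal pieces: it is shorter than
        \<open>d\<close>, and what remains is shorter than \<open>n * d\<close>.\<close>
      define w where "w = (if n = 0 then a else y - (y - a) / real (Suc n))"
      have n: "n \<noteq> 0" using False Suc.prems by (intro notI) auto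
      have y: "(y - a) / real (Suc n) < d"
        using Suc.prems by (simp add: field_simps)
      have w: "w = a + (y - a) * (real n / real (Suc n))"
        using n by (simp add: w_def field_simps)
      have "w - a = real n * ((y - a) / real (Suc n))"
        by (simp add: w)
      also have "\<dots> < real n * d"
        using y n by (intro mult_strict_left_mono) auto
      finally have "w - a < real n * d" .
      moreover have "a \<le> w" "w \<le> y"
        using Suc.prems n by (auto simp: w_def field_simps)
      moreover have "y - w < d" using y n by (simp add: w_def)
      ultimately show ?thesis
        using Suc.IH[of w] loc[of w y] Suc.prems by (simp add: algebra_simps)
    qed
  qed
  obtain n where "b - a < real n * d"
    using reals_Archimedean3[OF \<open>d > 0\<close>] by blast
  then show ?thesis using * assms(3) by blast
qed

lemma absolutely_integrable_mult_continuous: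
  assumes "(g :: real \<Rightarrow> real) absolutely_integrable_on {a..b}" "continuous_on {a..b} v"
  shows "(\<lambda>x. g x * v x) absolutely_integrable_on {a..b}"
proof -
  have "bounded (v ` {a..b})"
    using assms(2) by (intro compact_imp_bounded compact_continuous_image) auto
  moreover have "v \<in> borel_measurable (lebesgue_on {a..b})"
    using assms(2) by (intro continuous_imp_measurable_on_sets_lebesgue) auto
  ultimately have "(\<lambda>x. v x * g x) absolutely_integrable_on {a..b}"
    using assms(1) by (intro absolutely_integrable_bounded_measurable_product_real) auto
  then show ?thesis by (simp add: mult.commute)
qed

text \<open>The defect \<open>D\<close> of the product rule is additive over intervals and \<open>o\<close> of the increment of
  \<open>\<integral>(\<bar>g\<bar> + \<bar>k\<bar>)\<close> by uniform continuity of the factors, hence it vanishes.\<close>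

lemma primitive_on_mult:
  assumes u: "primitive_on a b u g" and v: "primitive_on a b v k"
  shows "primitive_on a b (\<lambda>x. u x * v x) (\<lambda>x. g x * v x + k x * u x)"
proof (rule primitive_onI)
  let ?f = "\<lambda>x. g x * v x + k x * u x"
  note cu = primitive_on_continuous[OF u] and cv = primitive_on_continuous[OF v]
  note gi = primitive_on_abs_integrable[OF u] and ki = primitive_on_abs_integrable[OF v]
  show fi: "?f absolutely_integrable_on {a..b}"
    using cu cv gi ki by (intro set_integral_add absolutely_integrable_mult_continuous)
  have fint: "?f integrable_on {x..y}" if "a \<le> x" "y \<le> b" for x y
    using fi that by (intro integrable_on_subinterval[OF set_lebesgue_integral_eq_integral(1)]) auto
  have mi: "(\<lambda>x. \<bar>g x\<bar> + \<bar>k x\<bar>) absolutely_integrable_on {a..b}"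
    using gi ki by (intro set_integral_add set_integrable_abs)
  have mint: "(\<lambda>x. \<bar>g x\<bar> + \<bar>k x\<bar>) integrable_on {x..y}" if "a \<le> x" "y \<le> b" for x y
    using mi that by (intro integrable_on_subinterval[OF set_lebesgue_integral_eq_integral(1)]) auto
  define D where "D = (\<lambda>x. u x * v x - integral {a..x} ?f)"
  define G where "G = (\<lambda>x. integral {a..x} (\<lambda>t. \<bar>g t\<bar> + \<bar>k t\<bar>))"
  have D0: "D x = D a" if x: "a \<le> x" "x \<le> b" for x
  proof -
    have bnd: "\<bar>D x - D a\<bar> \<le> e * (G x - G a)" if "e > 0" for e
    proof -
      have "uniformly_continuous_on {a..b} u" "uniformly_continuous_on {a..b} v"
        using cu cv by (auto intro: compact_uniformly_continuous)
      then obtain d1 d2 where d: "d1 > 0" "d2 > 0"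
        "\<And>s t. s \<in> {a..b} \<Longrightarrow> t \<in> {a..b} \<Longrightarrow> \<bar>s - t\<bar> < d1 \<Longrightarrow> \<bar>u s - u t\<bar> < e"
        "\<And>s t. s \<in> {a..b} \<Longrightarrow> t \<in> {a..b} \<Longrightarrow> \<bar>s - t\<bar> < d2 \<Longrightarrow> \<bar>v s - v t\<bar> < e"
        using \<open>e > 0\<close> unfolding uniformly_continuous_on_def dist_real_def by metis
      show ?thesis
      proof (rule local_increment_bound_imp_global[of "min d1 d2"])
        fix y z assume yz: "a \<le> y" "y \<le> z" "z \<le> x" "z - y < min d1 d2"
        have zb: "z \<le> b" using yz x by simp
        have "integral {a..y} ?f + integral {y..z} ?f = integral {a..z} ?f"
          using yz zb by (intro Henstock_Kurzweil_Integration.integral_combine fint) auto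
        then have Deq: "D z - D y = u z * v z - u y * v y - integral {y..z} ?f"
          by (simp add: D_def)
        have "integral {a..y} (\<lambda>t. \<bar>g t\<bar> + \<bar>k t\<bar>) + integral {y..z} (\<lambda>t. \<bar>g t\<bar> + \<bar>k t\<bar>)
            = integral {a..z} (\<lambda>t. \<bar>g t\<bar> + \<bar>k t\<bar>)"
          using yz zb by (intro Henstock_Kurzweil_Integration.integral_combine mint) auto
        then have Geq: "G z - G y = integral {y..z} (\<lambda>t. \<bar>g t\<bar> + \<bar>k t\<bar>)"
          by (simp add: G_def)
        \<comment> \<open>Freezing the two factors at opposite endpoints, \<open>v z\<close> and
          \<open>u y\<close>, makes the increments add up to exactly
          \<open>u z * v z - u y * v y\<close>.\<close>
        have "((\<lambda>t. v z * g t + u y * k t - ?f t) has_integral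
            (v z * (u z - u y) + u y * (v z - v y) - integral {y..z} ?f)) {y..z}"
          using yz zb fint[of y z]
          by (intro has_integral_add has_integral_diff has_integral_mult_right
              primitive_on_has_integral[OF u] primitive_on_has_integral[OF v] integrable_integral) auto
        then have hi: "((\<lambda>t. v z * g t + u y * k t - ?f t) has_integral (D z - D y)) {y..z}"
          by (simp add: Deq algebra_simps)
        have "norm (integral {y..z} (\<lambda>t. v z * g t + u y * k t - ?f t))
           \<le> integral {y..z} (\<lambda>t. e * (\<bar>g t\<bar> + \<bar>k t\<bar>))"
        proof (rule integral_norm_bound_integral)
          show "(\<lambda>t. e * (\<bar>g t\<bar> + \<bar>k t\<bar>)) integrable_on {y..z}"
            using mint[of y z] yz zb by (intro integrable_on_mult_right) auto
          fix t assume t: "t \<in> {y..z}"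
          have "\<bar>v z - v t\<bar> \<le> e" "\<bar>u y - u t\<bar> \<le> e"
            using d(4)[of z t] d(3)[of y t] t yz zb by auto
          then have "\<bar>(v z - v t) * g t\<bar> \<le> e * \<bar>g t\<bar>" "\<bar>(u y - u t) * k t\<bar> \<le> e * \<bar>k t\<bar>"
            by (auto simp: abs_mult intro!: mult_right_mono)
          then show "norm (v z * g t + u y * k t - ?f t) \<le> e * (\<bar>g t\<bar> + \<bar>k t\<bar>)"
            unfolding real_norm_def by (simp add: algebra_simps)
        qed (use hi in auto)
        then show "\<bar>D z - D y\<bar> \<le> e * (G z - G y)"
          using hi by (simp add: Geq has_integral_iff)
      qed (use d x in auto)
    qed
    have G: "G x - G a \<ge> 0" unfolding G_def by (simp add: integral_nonneg mint x)
    show ?thesis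
    proof (rule ccontr)
      assume "D x \<noteq> D a"
      define p where "p = \<bar>D x - D a\<bar>"
      have p: "p > 0" using \<open>D x \<noteq> D a\<close> by (simp add: p_def)
      \<comment> \<open>This choice of the error factor forces the bound below \<open>p\<close>; the
        summand 1 keeps the denominator positive when \<open>G\<close> does not increase.\<close>
      have "p \<le> p / (2 * (G x - G a + 1)) * (G x - G a)"
        unfolding p_def by (rule bnd) (use p G in \<open>simp add: p_def\<close>)
      also have "\<dots> < p"
      proof -
        have "(G x - G a) / (2 * (G x - G a + 1)) < 1"
          using G by (subst pos_divide_less_eq) auto
        from mult_strict_left_mono[OF this p] show ?thesis by simp
      qed
      finally show False by simp
    qed
  qed
  show "(?f has_integral (u x * v x - u a * v a)) {a..x}" if "a \<le> x" "x \<le> b" for x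
    using D0[OF that] fint[of a x] that by (simp add: D_def has_integral_iff)
qed

text \<open>Dynkin argument: half-lines form an intersection-stable generator of the Borel sets, and
  a vanishing integral passes to complements and disjoint unions. The complement case needs the
  integral over the whole line, obtained as a limit over growing half-lines.\<close>

lemma set_integral_eq_0_imp_AE_eq_0:
  fixes f :: "real \<Rightarrow> real"
  assumes f: "integrable lborel f"
    and z: "\<And>x. (LINT t:{..x}|lborel. f t) = 0"
  shows "AE x in lborel. f x = 0"
proof -
  have fs: "set_integrable lborel A f" if "A \<in> sets borel" for A
    unfolding set_integrable_def using f that by (intro integrable_mult_indicator) auto
  have lim: "(\<lambda>n. LINT t:{..real n}|lborel. f t) \<longlonglongrightarrow> (LINT t:(\<Union>n. {..real n})|lborel. f t)"
    by (rule set_integral_cont_up) (auto intro!: fs simp: incseq_def)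
  have un: "(\<Union>n. {..real n}) = (UNIV::real set)"
    using real_arch_simple by auto
  have tot: "(LINT t:UNIV|lborel. f t) = 0"
    using lim z by (simp add: un LIMSEQ_const_iff)
  have zero: "(LINT t:A|lborel. f t) = 0" if "A \<in> sigma_sets UNIV (range (\<lambda>x::real. {..x}))" for A
  proof -
    have st: "Int_stable (range (\<lambda>x::real. {..x}))"
      by (auto simp: Int_stable_def)
    have sb: "sigma_sets UNIV (range (\<lambda>x::real. {..x})) = sets borel"
      by (subst borel_eq_atMost) simp
    have "range (\<lambda>x::real. {..x}) \<subseteq> Pow UNIV" by simp
    from st this that show ?thesis
    proof (induct A rule: sigma_sets_induct_disjoint)
      case (basic A)
      then show ?case using z by auto
    next
      case empty
      then show ?case by (simp add: set_lebesgue_integral_def)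
    next
      case (compl A)
      have "(LINT t:(UNIV - A) \<union> A|lborel. f t) = (LINT t:UNIV - A|lborel. f t) + (LINT t:A|lborel. f t)"
        using compl by (intro set_integral_Un fs) (auto simp: sb)
      then show ?case using tot compl by simp
    next
      case (union A)
      have "(LINT t:(\<Union>i. A i)|lborel. f t) = (\<Sum>i. (LINT t:(A i)|lborel. f t))"
        using union by (intro lebesgue_integral_countable_add fs)
          (auto simp: sb disjoint_family_on_def intro!: sets.countable_UN)
      then show ?case using union by simp
    qed
  qed
  show ?thesis
  proof (rule density_unique_real[OF f, of "\<lambda>_. 0", simplified])
    fix A :: "real set" assume "A \<in> sets borel"
    then show "(LINT t:A|lborel. f t) = 0"
      by (intro zero) (simp add: borel_eq_atMost)
  qed
qed

text \<open>Half-lines generate only the Borel sets, while \<open>f\<close> is merely Lebesgue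
  measurable. A Borel modification \<open>F'\<close> of the extension of \<open>f\<close> by zero
  carries the question over to \<open>lborel\<close>.\<close>

lemma integral_eq_0_imp_AE_eq_0:
  fixes f :: "real \<Rightarrow> real"
  assumes f: "f absolutely_integrable_on {a..b}"
    and z: "\<And>x. a \<le> x \<Longrightarrow> x \<le> b \<Longrightarrow> integral {a..x} f = 0"
  shows "AE x in lebesgue. x \<in> {a..b} \<longrightarrow> f x = 0"
proof -
  define F where "F x = indicator {a..b} x * f x" for x
  have F: "integrable lebesgue F" using f by (simp add: set_integrable_def F_def[abs_def])
  then obtain F' where F': "F' \<in> borel_measurable lborel" "AE x in lborel. F x = F' x"
    using completion_ex_borel_measurable_real[of F lborel] by (auto dest: borel_measurable_integrable)
  have eq: "AE x in lebesgue. F x = F' x"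
    using F'(2) by (rule AE_completion)
  have F'm: "F' \<in> borel_measurable lebesgue"
    using F'(1) by (rule measurable_completion)
  have "integrable lebesgue F'"
    by (rule integrable_cong_AE_imp[OF F F'm]) (use eq in auto)
  then have iF': "integrable lborel F'"
    using F'(1) by (subst (asm) integrable_completion) auto
  have "(LINT t:{..x}|lborel. F' t) = 0" for x
  proof -
    have "(LINT t:{..x}|lborel. F' t) = (LINT t:{..x}|lebesgue. F' t)"
      unfolding set_lebesgue_integral_def using F'(1)
      by (intro integral_completion[symmetric]) auto
    also have "\<dots> = (LINT t:{..x}|lebesgue. F t)"
      unfolding set_lebesgue_integral_def
      by (rule integral_cong_AE) (use eq F F'm in \<open>auto intro!: borel_measurable_times borel_measurable_indicator\<close>)
    also have "\<dots> = (LINT t:{a..min x b}|lebesgue. f t)"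
      unfolding set_lebesgue_integral_def F_def
      by (intro Bochner_Integration.integral_cong) (auto simp: indicator_def)
    also have "\<dots> = integral {a..min x b} f"
      using f by (intro set_lebesgue_integral_eq_integral absolutely_integrable_on_subinterval[OF f]) auto
    also have "\<dots> = 0"
      using z[of "min x b"] by (cases "a \<le> min x b") auto
    finally show ?thesis .
  qed
  then have "AE x in lborel. F' x = 0"
    by (rule set_integral_eq_0_imp_AE_eq_0[OF iF'])
  then have "AE x in lebesgue. F' x = 0" by (rule AE_completion)
  with eq show ?thesis
    by eventually_elim (auto simp: F_def)
qed

lemma primitive_on_AE_unique:
  assumes "primitive_on a b u g" "primitive_on a b u k"
  shows "AE x in lebesgue. x \<in> {a..b} \<longrightarrow> g x = k x"
proof -
  have "AE x in lebesgue. x \<in> {a..b} \<longrightarrow> g x - k x = 0"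
  proof (rule integral_eq_0_imp_AE_eq_0)
    show "(\<lambda>x. g x - k x) absolutely_integrable_on {a..b}"
      using assms by (intro set_integral_diff) (auto dest: primitive_on_abs_integrable)
    show "integral {a..x} (\<lambda>x. g x - k x) = 0" if "a \<le> x" "x \<le> b" for x
      using has_integral_diff[OF primitive_on_has_integral[OF assms(1), of a x]
          primitive_on_has_integral[OF assms(2), of a x]] that
      by (auto simp: has_integral_iff)
  qed
  then show ?thesis by simp
qed

section \<open>Weak derivatives\<close>

lemma continuous_imp_antiderivative:
  fixes f :: "real \<Rightarrow> real"
  assumes "continuous_on UNIV f"
  obtains F where "\<And>x. (F has_real_derivative f x) (at x)"
proof -
  have "isCont f x" for x
    using assms by (simp add: continuous_on_eq_continuous_at)
  then obtain F where "\<And>x. (F has_vector_derivative f x) (at x)"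
    using einterval_antiderivative[of "-\<infinity>" "\<infinity>" f] by auto
  then show thesis by (intro that[of F]) (simp add: has_real_derivative_iff_has_vector_derivative)
qed

lemma test_fun_primitive_on:
  assumes "test_fun \<eta>"
  shows "primitive_on 0 1 \<eta> (deriv \<eta>)" "\<eta> 0 = 0" "\<eta> 1 = 0" "continuous_on UNIV (deriv \<eta>)"
proof -
  obtain D where D: "\<And>x. (\<eta> has_vector_derivative D x) (at x)" "continuous_on UNIV D"
    using assms by (auto simp: test_fun_def C1_differentiable_on_def)
  have D': "(\<eta> has_real_derivative D x) (at x)" for x
    using D(1) by (simp add: has_real_derivative_iff_has_vector_derivative)
  then have eq: "deriv \<eta> = D" by (auto intro: DERIV_imp_deriv)
  show "continuous_on UNIV (deriv \<eta>)" using D eq by simp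
  show "primitive_on 0 1 \<eta> (deriv \<eta>)"
    unfolding eq using D' D(2)
    by (intro primitive_on_C1) (auto intro: has_field_derivative_at_within continuous_on_subset)
  have "{x. \<eta> x \<noteq> 0} \<subseteq> {0<..<1}"
    using assms closure_subset[of "{x. \<eta> x \<noteq> 0}"] by (auto simp: test_fun_def)
  then show "\<eta> 0 = 0" "\<eta> 1 = 0" by auto
qed

lemma test_fun_parts:
  assumes r: "primitive_on 0 1 r g" and \<eta>: "test_fun \<eta>"
  shows "((\<lambda>x. g x * \<eta> x + deriv \<eta> x * r x) has_integral 0) {0..1}"
  using primitive_on_has_integral[OF primitive_on_mult[OF r test_fun_primitive_on(1)[OF \<eta>]], of 0 1]
    test_fun_primitive_on(2,3)[OF \<eta>] by simp

text \<open>The antiderivative normalised at 0 is constant on both sides of \<open>{c..d}\<close>;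
  the vanishing integral makes the constant on the right zero as well, which yields compact
  support.\<close>

lemma test_fun_from_integrand:
  assumes f: "continuous_on UNIV f" and cd: "0 < c" "c \<le> d" "d < (1::real)"
    and supp: "\<And>x. x \<notin> {c..d} \<Longrightarrow> f x = 0" and int: "(f has_integral 0) {0..1}"
  obtains \<eta> where "test_fun \<eta>" "deriv \<eta> = f"
proof -
  obtain F where F: "\<And>x. (F has_real_derivative f x) (at x)"
    using continuous_imp_antiderivative[OF f] by blast
  have FTC: "(f has_integral (F y - F x)) {x..y}" if "x \<le> y" for x y
    using that F by (intro fundamental_theorem_of_calculus)
      (auto simp flip: has_real_derivative_iff_has_vector_derivative intro: has_field_derivative_at_within)
  have F01: "F 1 = F 0"
    using has_integral_unique[OF FTC[of 0 1] int] by simp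
  have const: "F x = F y" if "x \<le> y" "\<And>t. t \<in> {x..<y} \<Longrightarrow> t \<notin> {c..d}" for x y
  proof -
    have "(f has_integral 0) {x..y}"
      by (rule has_integral_spike_finite[of "{y}" _ _ "\<lambda>_. 0"]) (use that supp in auto)
    from has_integral_unique[OF FTC[OF that(1)] this] show ?thesis by simp
  qed
  have const': "F x = F y" if "x \<le> y" "\<And>t. t \<in> {x<..y} \<Longrightarrow> t \<notin> {c..d}" for x y
  proof -
    have "(f has_integral 0) {x..y}"
      by (rule has_integral_spike_finite[of "{x}" _ _ "\<lambda>_. 0"]) (use that supp in auto)
    from has_integral_unique[OF FTC[OF that(1)] this] show ?thesis by simp
  qed
  define \<eta> where "\<eta> x = F x - F 0" for x
  have d\<eta>: "(\<eta> has_real_derivative f x) (at x)" for x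
    unfolding \<eta>_def using F[of x] by (auto intro!: derivative_eq_intros)
  have "\<eta> x = 0" if "x \<notin> {c..d}" for x
  proof (cases "x < c")
    case True
    then show ?thesis
      using const[of x 0] const[of 0 x] cd by (cases "x \<le> 0") (auto simp: \<eta>_def)
  next
    case False
    then have "d < x" using that by auto
    then show ?thesis
      using const'[of x 1] const'[of 1 x] cd F01 by (cases "x \<le> 1") (auto simp: \<eta>_def)
  qed
  then have "{x. \<eta> x \<noteq> 0} \<subseteq> {c..d}" by blast
  then have "closure {x. \<eta> x \<noteq> 0} \<subseteq> {c..d}"
    by (rule closure_minimal) simp
  moreover have "\<eta> C1_differentiable_on UNIV"
    unfolding C1_differentiable_on_def using d\<eta> f
    by (auto simp: has_real_derivative_iff_has_vector_derivative intro!: exI[of _ f])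
  ultimately have "test_fun \<eta>" using cd by (auto simp: test_fun_def)
  moreover have "deriv \<eta> = f" using d\<eta> by (auto intro: DERIV_imp_deriv)
  ultimately show thesis by (rule that)
qed

text \<open>Du Bois-Reymond: testing \<open>w\<close> against the derivative \<open>(w - m) \<xi>\<close>, with \<open>m\<close> the mean of \<open>w\<close>
  for the weight \<open>\<xi>\<close>, gives \<open>\<integral>(w - m)\<^sup>2 \<xi> = 0\<close>.\<close>

lemma weakly_constant_imp_constant:
  assumes w: "continuous_on {0..1} w"
    and z: "\<And>\<eta>. test_fun \<eta> \<Longrightarrow> integral {0..1} (\<lambda>x. w x * deriv \<eta> x) = 0"
    and x: "x \<in> {0..1}"
  shows "w x = w 0"
proof -
  \<comment> \<open>Constant extension beyond the unit interval, so that the integrand built from it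
    is continuous on the whole line.\<close>
  define W where "W x = w (max 0 (min 1 x))" for x
  have W: "continuous_on UNIV W"
    unfolding W_def
    by (rule continuous_on_compose2[OF w]) (auto intro!: continuous_intros)
  have Ww: "W x = w x" if "x \<in> {0..1}" for x using that by (simp add: W_def)
  have loc: "\<exists>m. \<forall>x\<in>{c<..<d}. w x = m" if cd: "0 < c" "c < d" "d < 1" for c d
  proof -
    \<comment> \<open>A weight that is merely continuous is enough, since
      \<open>(W x - m) * \<xi> x\<close> becomes the derivative of the test function.\<close>
    define \<xi> where "\<xi> x = max 0 ((x - c) * (d - x))" for x
    have \<xi>: "continuous_on A \<xi>" for A
      unfolding \<xi>_def by (intro continuous_intros)
    have \<xi>0: "\<xi> x = 0" if "x \<notin> {c..d}" for x
    proof (cases "x < c")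
      case True
      then show ?thesis using mult_nonpos_nonneg[of "x - c" "d - x"] cd by (simp add: \<xi>_def)
    next
      case False
      then show ?thesis
        using mult_nonneg_nonpos[of "x - c" "d - x"] that cd by (simp add: \<xi>_def)
    qed
    have \<xi>pos: "\<xi> x > 0" if "x \<in> {c<..<d}" for x
      using that by (auto simp: \<xi>_def less_max_iff_disj)
    have \<xi>nn: "\<xi> x \<ge> 0" for x
      by (simp add: \<xi>_def)
    have "integral {0..1} \<xi> \<noteq> 0"
    proof
      assume "integral {0..1} \<xi> = 0"
      then have "\<forall>x\<in>{0..1}. \<xi> x = 0"
        by (subst (asm) integral_eq_0_iff) (auto simp: \<xi> \<xi>nn)
      moreover have "(c + d) / 2 \<in> {0..1}" using cd by auto
      ultimately show False using \<xi>pos[of "(c + d) / 2"] cd by auto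
    qed
    define m where "m = integral {0..1} (\<lambda>x. W x * \<xi> x) / integral {0..1} \<xi>"
    define f where "f x = (W x - m) * \<xi> x" for x
    have f: "continuous_on UNIV f"
      unfolding f_def by (intro continuous_intros W \<xi>)
    have fA: "continuous_on A f" for A using f continuous_on_subset by blast
    have WA: "continuous_on A W" for A using W continuous_on_subset by blast
    have "integral {0..1} f = integral {0..1} (\<lambda>x. W x * \<xi> x - m * \<xi> x)"
      by (simp add: f_def[abs_def] algebra_simps)
    also have "\<dots> = integral {0..1} (\<lambda>x. W x * \<xi> x) - m * integral {0..1} \<xi>"
      by (subst integral_diff) (auto intro!: integrable_continuous_real continuous_intros WA \<xi>)
    also have "\<dots> = 0" using \<open>integral {0..1} \<xi> \<noteq> 0\<close> by (simp add: m_def)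
    finally have f0: "integral {0..1} f = 0" .
    then have hf: "(f has_integral 0) {0..1}"
      using integrable_continuous_real[OF fA[of "{0..1}"]] by (simp add: has_integral_iff)
    obtain \<eta> where \<eta>: "test_fun \<eta>" "deriv \<eta> = f"
      using test_fun_from_integrand[OF f \<open>0 < c\<close> _ \<open>d < 1\<close> _ hf] cd \<xi>0 by (auto simp: f_def)
    have "integral {0..1} (\<lambda>x. W x * f x) = 0"
    proof -
      have "integral {0..1} (\<lambda>x. W x * f x) = integral {0..1} (\<lambda>x. w x * f x)"
        by (rule integral_cong) (simp add: Ww)
      then show ?thesis using z[OF \<eta>(1)] \<eta>(2) by simp
    qed
    then have "integral {0..1} (\<lambda>x. W x * f x - m * f x) = 0"
      using f0 by (subst integral_diff) (auto intro!: integrable_continuous_real continuous_intros WA fA)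
    moreover have "(\<lambda>x. W x * f x - m * f x) = (\<lambda>x. (W x - m)\<^sup>2 * \<xi> x)"
      by (auto simp: f_def algebra_simps power2_eq_square)
    ultimately have "integral {0..1} (\<lambda>x. (W x - m)\<^sup>2 * \<xi> x) = 0" by simp
    then have all0: "\<forall>x\<in>{0..1}. (W x - m)\<^sup>2 * \<xi> x = 0"
      by (subst (asm) integral_eq_0_iff) (auto intro!: continuous_intros WA \<xi> simp: \<xi>nn)
    then have "W x = m" if "x \<in> {c<..<d}" for x
    proof -
      have "(W x - m)\<^sup>2 * \<xi> x = 0"
        using all0 that cd by simp
      then show ?thesis using \<xi>pos[OF that] by simp
    qed
    then show ?thesis using Ww cd by (intro exI[of _ m]) auto
  qed
  have "w x = w (1/2)" if "x \<in> {0<..<1}" for x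
  proof -
    \<comment> \<open>An interval compactly inside the unit interval that contains both
      \<open>x\<close> and \<open>1/2\<close>, so the local constants all agree with the value at
      \<open>1/2\<close>.\<close>
    have "0 < x / 4" "x / 4 < (x + 3) / 4" "(x + 3) / 4 < 1" using that by auto
    then obtain m where m: "\<forall>y\<in>{x / 4<..<(x + 3) / 4}. w y = m"
      using loc by blast
    have "x \<in> {x / 4<..<(x + 3) / 4}" "1/2 \<in> {x / 4<..<(x + 3) / 4}" using that by auto
    then have "w x = m" "w (1/2) = m" using m by blast+
    then show ?thesis by simp
  qed
  note open_const = this
  have half: "w y = w (1/2)" if "y \<in> {0..1}" for y
  proof (rule continuous_constant_on_closure[of "{0<..<1}" w "w (1/2)" y])
    show "w x = w (1/2)" if "x \<in> {0<..<1}" for x by (rule open_const[OF that])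
  qed (use w that in auto)
  have half0: "w 0 = w (1/2)" by (rule half) simp
  show ?thesis unfolding half[OF x] half0 ..
qed

text \<open>The difference of \<open>r\<close> and the indefinite integral of \<open>g\<close> has
  weak derivative zero, so it is constant; continuity of \<open>r\<close> extends this to both
  endpoints.\<close>

lemma has_weak_deriv_imp_primitive_on:
  assumes r: "continuous_on {0..1} r" and g: "has_weak_deriv r g"
  shows "primitive_on 0 1 r g"
proof -
  have gi: "g absolutely_integrable_on {0..1}"
    using g by (simp add: has_weak_deriv_def absolutely_integrable_on_Icc_iff_Ioo)
  define G where "G x = integral {0..x} g" for x
  have G: "primitive_on 0 1 G g"
  proof (rule primitive_onI[OF gi])
    show "(g has_integral (G x - G 0)) {0..x}" if "0 \<le> x" "x \<le> 1" for x
      using that gi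
      by (auto simp: G_def has_integral_iff intro!: integrable_on_subinterval[OF set_lebesgue_integral_eq_integral(1)[OF gi]])
  qed
  have w: "r x - G x = r 0 - G 0" if "x \<in> {0..1}" for x
  proof (rule weakly_constant_imp_constant[OF _ _ that])
    show "continuous_on {0..1} (\<lambda>x. r x - G x)"
      using r primitive_on_continuous[OF G] by (intro continuous_intros)
    fix \<eta> assume \<eta>: "test_fun \<eta>"
    note T = test_fun_primitive_on[OF \<eta>]
    have cd: "continuous_on {0..1} (deriv \<eta>)" using T(4) continuous_on_subset by blast
    have i1: "(\<lambda>x. r x * deriv \<eta> x) absolutely_integrable_on {0..1}"
      using r cd by (intro absolutely_integrable_continuous_real continuous_intros)
    have i2: "(\<lambda>x. g x * \<eta> x) absolutely_integrable_on {0..1}"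
      using gi primitive_on_continuous[OF T(1)] by (rule absolutely_integrable_mult_continuous)
    have "integral {0<..<1} (\<lambda>x. r x * deriv \<eta> x) = - integral {0<..<1} (\<lambda>x. g x * \<eta> x)"
    proof -
      have "(LINT x:{0<..<1}|lebesgue. r x * deriv \<eta> x) = - (LINT x:{0<..<1}|lebesgue. g x * \<eta> x)"
        using g \<eta> by (simp add: has_weak_deriv_def)
      then show ?thesis
        using i1 i2 unfolding absolutely_integrable_on_Icc_iff_Ioo
        by (simp add: set_lebesgue_integral_eq_integral(2))
    qed
    then have eq: "integral {0..1} (\<lambda>x. r x * deriv \<eta> x) = - integral {0..1} (\<lambda>x. g x * \<eta> x)"
      by (simp add: integral_open_interval_real)
    have "integral {0..1} (\<lambda>x. (r x * deriv \<eta> x + g x * \<eta> x) - (g x * \<eta> x + deriv \<eta> x * G x))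
       = (integral {0..1} (\<lambda>x. r x * deriv \<eta> x) + integral {0..1} (\<lambda>x. g x * \<eta> x)) - 0"
      using set_lebesgue_integral_eq_integral(1)[OF i1] set_lebesgue_integral_eq_integral(1)[OF i2]
        test_fun_parts[OF G \<eta>]
      by (intro integral_unique has_integral_diff has_integral_add integrable_integral)
    then show "integral {0..1} (\<lambda>x. (r x - G x) * deriv \<eta> x) = 0"
      using eq by (simp add: algebra_simps)
  qed
  show ?thesis
  proof (rule primitive_onI[OF gi])
    show "(g has_integral (r x - r 0)) {0..x}" if "0 \<le> x" "x \<le> 1" for x
    proof -
      have "r x - r 0 = G x - G 0" using w[of x] that by simp
      then show ?thesis using primitive_on_has_integral[OF G, of 0 x] that by simp
    qed
  qed
qed

lemma primitive_on_imp_has_weak_deriv: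
  assumes r: "primitive_on 0 1 r g"
  shows "has_weak_deriv r g"
  unfolding has_weak_deriv_def
proof (intro conjI allI impI)
  note gi = primitive_on_abs_integrable[OF r]
  show "set_integrable lebesgue {0<..<1} g"
    using gi by (simp add: absolutely_integrable_on_Icc_iff_Ioo)
  fix \<eta> assume \<eta>: "test_fun \<eta>"
  note T = test_fun_primitive_on[OF \<eta>]
  have cd: "continuous_on {0..1} (deriv \<eta>)" using T(4) continuous_on_subset by blast
  have i1: "(\<lambda>x. r x * deriv \<eta> x) absolutely_integrable_on {0..1}"
    using primitive_on_continuous[OF r] cd
    by (intro absolutely_integrable_continuous_real continuous_intros)
  have i2: "(\<lambda>x. g x * \<eta> x) absolutely_integrable_on {0..1}"
    using gi primitive_on_continuous[OF T(1)] by (rule absolutely_integrable_mult_continuous)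
  have "integral {0..1} (\<lambda>x. r x * deriv \<eta> x) + integral {0..1} (\<lambda>x. g x * \<eta> x) = 
      integral {0..1} (\<lambda>x. g x * \<eta> x + deriv \<eta> x * r x)"
    using set_lebesgue_integral_eq_integral(1)[OF i1] set_lebesgue_integral_eq_integral(1)[OF i2]
    by (subst integral_add[symmetric]) (auto simp: algebra_simps)
  then have "integral {0..1} (\<lambda>x. r x * deriv \<eta> x) = - integral {0..1} (\<lambda>x. g x * \<eta> x)"
    using integral_unique[OF test_fun_parts[OF r \<eta>]] by simp
  then show "(LINT x:{0<..<1}|lebesgue. r x * deriv \<eta> x) = - (LINT x:{0<..<1}|lebesgue. g x * \<eta> x)"
    using i1 i2 unfolding absolutely_integrable_on_Icc_iff_Ioo
    by (simp add: set_lebesgue_integral_eq_integral(2) integral_open_interval_real)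
qed

text \<open>Trades the distributional definition for an integral representation, in which products,
  rescaling and splicing can be computed.\<close>

lemma W11_iff_primitive_on: "r \<in> W11 \<longleftrightarrow> (\<exists>g. primitive_on 0 1 r g)"
proof
  assume "r \<in> W11"
  then show "\<exists>g. primitive_on 0 1 r g"
    unfolding W11_def by (auto intro: has_weak_deriv_imp_primitive_on)
next
  assume "\<exists>g. primitive_on 0 1 r g"
  then obtain g where g: "primitive_on 0 1 r g" ..
  show "r \<in> W11"
    unfolding W11_def using primitive_on_continuous[OF g] primitive_on_imp_has_weak_deriv[OF g] by auto
qed

text \<open>Removes the choice operator: for integrals and almost-everywhere statements any density
  of \<open>r\<close> may stand in for \<open>weak_deriv r\<close>.\<close>

lemma weak_deriv_AE_eq:
  assumes "primitive_on 0 1 r g"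
  shows "AE R in lebesgue. R \<in> {0..1} \<longrightarrow> weak_deriv r R = g R"
proof -
  have "has_weak_deriv r (weak_deriv r)"
    unfolding weak_deriv_def
    by (rule someI[where P = "has_weak_deriv r", OF primitive_on_imp_has_weak_deriv[OF assms]])
  then have "primitive_on 0 1 r (weak_deriv r)"
    by (rule has_weak_deriv_imp_primitive_on[OF primitive_on_continuous[OF assms]])
  then show ?thesis using assms by (rule primitive_on_AE_unique)
qed

section \<open>Radial maps and their energy\<close>

text \<open>Positivity is demanded at every point rather than almost everywhere, so that the
  convexity and growth inequalities apply pointwise; \<open>admissibleE\<close> arranges this by a
  change on a null set.\<close>

definition radial_pair :: "(real \<Rightarrow> real) \<Rightarrow> (real \<Rightarrow> real) \<Rightarrow> bool" where
  "radial_pair s g \<longleftrightarrow> primitive_on 0 1 s g \<and> (\<forall>R\<in>{0..1}. g R > 0) \<and> s 0 \<ge> 0"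

text \<open>The factor \<open>R^2\<close> cancels whatever the conventions of division produce at
  \<open>R = 0\<close>, so closed intervals can be used throughout.\<close>

definition energy_density ::
  "(real \<Rightarrow> real \<Rightarrow> real \<Rightarrow> real \<Rightarrow> real) \<Rightarrow> (real \<Rightarrow> real) \<Rightarrow> (real \<Rightarrow> real) \<Rightarrow> real \<Rightarrow> real" where
  "energy_density \<Phi> s g R = \<Phi> R (g R) (s R / R) (s R / R) * R\<^sup>2"

lemma energy_density_0 [simp]: "energy_density \<Phi> s g 0 = 0"
  by (simp add: energy_density_def)

lemma primitive_on_AE_cong:
  assumes u: "primitive_on a b u g" and eq: "AE x in lebesgue. x \<in> {a..b} \<longrightarrow> g x = k x"
  shows "primitive_on a b u k"
proof -
  obtain N where N: "negligible N" "{x. \<not> (x \<in> {a..b} \<longrightarrow> g x = k x)} \<subseteq> N"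
    using eq unfolding eventually_ae_filter_negligible by blast
  show ?thesis
  proof (rule primitive_onI)
    show "k absolutely_integrable_on {a..b}"
      by (rule absolutely_integrable_spike[OF primitive_on_abs_integrable[OF u] N(1)]) (use N(2) in auto)
    show "(k has_integral u x - u a) {a..x}" if "a \<le> x" "x \<le> b" for x
      by (rule has_integral_spike[OF N(1) _ primitive_on_has_integral[OF u]]) (use N(2) that in auto)
  qed
qed

lemma radial_pair_primitive: "radial_pair s g \<Longrightarrow> primitive_on 0 1 s g"
  by (simp add: radial_pair_def)

lemma radial_pair_deriv_pos: "radial_pair s g \<Longrightarrow> 0 \<le> R \<Longrightarrow> R \<le> 1 \<Longrightarrow> g R > 0"
  by (simp add: radial_pair_def)

lemma radial_pair_mono:
  assumes "radial_pair s g" "0 \<le> x" "x \<le> y" "y \<le> 1"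
  shows "s x \<le> s y"
proof -
  have "(g has_integral (s y - s x)) {x..y}"
    using primitive_on_has_integral[OF radial_pair_primitive[OF assms(1)] assms(2-4)] .
  then have "0 \<le> s y - s x"
  proof (rule has_integral_nonneg)
    show "0 \<le> g t" if "t \<in> {x..y}" for t
      using radial_pair_deriv_pos[OF assms(1), of t] that assms by simp
  qed
  then show ?thesis by simp
qed

text \<open>If \<open>s R\<close> vanished, monotonicity would make \<open>s\<close> constant on
  \<open>{0..R}\<close>, and its density would be zero almost everywhere on an interval of positive
  length.\<close>

lemma radial_pair_pos:
  assumes "radial_pair s g" "0 < R" "R \<le> 1"
  shows "s R > 0"
proof (rule ccontr)
  assume "\<not> s R > 0"
  then have s0: "s x = 0" if "0 \<le> x" "x \<le> R" for x
    using radial_pair_mono[OF assms(1), of 0 x] radial_pair_mono[OF assms(1), of x R] that assms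
    by (auto simp: radial_pair_def)
  have "primitive_on 0 R s g"
    using primitive_on_subset[OF radial_pair_primitive[OF assms(1)], of 0 R] assms by simp
  moreover have "primitive_on 0 R s (\<lambda>_. 0)"
  proof (rule primitive_onI)
    show "((\<lambda>_. 0) has_integral s x - s 0) {0..x}" if "0 \<le> x" "x \<le> R" for x
      using s0[of x] s0[of 0] that by simp
  qed simp
  ultimately have "AE x in lebesgue. x \<in> {0..R} \<longrightarrow> g x = 0"
    by (rule primitive_on_AE_unique)
  then obtain N where N: "negligible N" "{x. \<not> (x \<in> {0..R} \<longrightarrow> g x = 0)} \<subseteq> N"
    unfolding eventually_ae_filter_negligible by blast
  have "{0..R} \<subseteq> N"
  proof
    fix x assume x: "x \<in> {0..R}"
    then have "g x > 0" using assms by (intro radial_pair_deriv_pos) auto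
    then show "x \<in> N" using x N(2) by auto
  qed
  then have "negligible {0..R}" using N(1) negligible_subset by blast
  then show False using assms negligible_interval(1)[of 0 R] by (simp add: box_real)
qed

lemma radial_pair_continuous: "radial_pair s g \<Longrightarrow> continuous_on {0..1} s"
  by (intro primitive_on_continuous[OF radial_pair_primitive])

section \<open>Convexity, growth and the class of stored energies\<close>

lemma convex_tangent:
  assumes f: "convex_on {0<..} f" and x: "(x::real) > 0"
  obtains m where "\<And>y. y > 0 \<Longrightarrow> f y \<ge> f x + m * (y - x)"
  by (rule that, rule convex_le_Inf_differential[OF f]) (use x in \<open>auto simp: interior_open\<close>)

lemma strictly_convex_on_imp_convex_on:
  assumes "strictly_convex_on S f"
  shows "convex_on S f"
proof (rule convex_onI)
  show "convex S" using assms by (simp add: strictly_convex_on_def)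
  show "f ((1 - t) *\<^sub>R x + t *\<^sub>R y) \<le> (1 - t) * f x + t * f y"
    if "0 < t" "t < 1" "x \<in> S" "y \<in> S" for t x y
  proof (cases "x = y")
    case True
    then show ?thesis by (simp add: algebra_simps)
  next
    case False
    then show ?thesis using assms that by (auto simp: strictly_convex_on_def intro!: less_imp_le)
  qed
qed

lemma energy_growthE:
  assumes "energy_growth \<Phi>"
  obtains \<phi>' h' where "\<And>v. v > 0 \<Longrightarrow> \<phi>' v > 0" "\<And>d. d > 0 \<Longrightarrow> h' d > 0"
    "\<And>R v1 v2 v3. R \<in> {0..1} \<Longrightarrow> v1 > 0 \<Longrightarrow> v2 > 0 \<Longrightarrow> v3 > 0 \<Longrightarrow>
        \<Phi> R v1 v2 v3 \<ge> \<phi>' v1 + \<phi>' v2 + \<phi>' v3 + h' (v1 * v2 * v3)"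
    "filterlim (\<lambda>d. h' d / d) at_top at_top"
proof -
  from assms[unfolded energy_growth_def] obtain \<phi>' h' C q K s where A:
    "\<forall>v>0. \<phi>' v > (0::real)" "\<forall>d>0. h' d > (0::real)"
    "\<forall>R\<in>{0..1}. \<forall>v1>0. \<forall>v2>0. \<forall>v3>0. \<Phi> R v1 v2 v3 \<ge> \<phi>' v1 + \<phi>' v2 + \<phi>' v3 + h' (v1 * v2 * v3)"
    "filterlim (\<lambda>d. h' d / d) at_top at_top"
    by (elim exE conjE) (rule that)
  show thesis
  proof (rule that[of \<phi>' h'])
    show "\<phi>' v > 0" if "v > 0" for v using A(1) that by simp
    show "h' d > 0" if "d > 0" for d using A(2) that by simp
    show "\<Phi> R v1 v2 v3 \<ge> \<phi>' v1 + \<phi>' v2 + \<phi>' v3 + h' (v1 * v2 * v3)"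
      if "R \<in> {0..1}" "v1 > 0" "v2 > 0" "v3 > 0" for R v1 v2 v3
      using A(3) that by simp
  qed (rule A(4))
qed

text \<open>Interpreted twice: for the given coefficients and for those frozen at 0. The two
  variational problems thus share the same lemmas on energy and admissibility.\<close>

locale radial_energy =
  fixes \<alpha> \<beta> \<gamma> \<phi> \<psi> h :: "real \<Rightarrow> real"
  assumes cont_coeff: "continuous_on {0..1} \<alpha>" "continuous_on {0..1} \<beta>" "continuous_on {0..1} \<gamma>"
    and pos_coeff: "\<And>R. R \<in> {0..1} \<Longrightarrow> \<alpha> R > 0" "\<And>R. R \<in> {0..1} \<Longrightarrow> \<beta> R > 0" "\<And>R. R \<in> {0..1} \<Longrightarrow> \<gamma> R > 0"
    and convex: "convex_on {0<..} \<phi>" "convex_on {0<..} \<psi>" "convex_on {0<..} h"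
    and nonneg: "\<And>v. v > 0 \<Longrightarrow> \<phi> v \<ge> 0" "\<And>v. v > 0 \<Longrightarrow> \<psi> v \<ge> 0"
    and growth: "energy_growth (stored_energy \<alpha> \<beta> \<gamma> \<phi> \<psi> h)"
begin

abbreviation \<Phi> where "\<Phi> \<equiv> stored_energy \<alpha> \<beta> \<gamma> \<phi> \<psi> h"

text \<open>Beyond a threshold \<open>d0\<close> the growth of \<open>h'\<close> provides the slope
  \<open>N\<close>; below it the linear term is bounded and goes into \<open>D\<close>. Used with
  slope 1 to control the determinant by the energy, and with a large slope when
  \<open>r e / e\<close> blows up.\<close>

lemma superlinear_det:
  obtains D where "D \<ge> 0"
    "\<And>R v1 v2 v3. R \<in> {0..1} \<Longrightarrow> v1 > 0 \<Longrightarrow> v2 > 0 \<Longrightarrow> v3 > 0 \<Longrightarrow> \<Phi> R v1 v2 v3 \<ge> N * (v1 * v2 * v3) - D"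
proof -
  obtain \<phi>' h' where
    p: "\<And>v. v > 0 \<Longrightarrow> \<phi>' v > 0" and h: "\<And>d. d > 0 \<Longrightarrow> h' d > 0" and
    g: "\<And>R v1 v2 v3. R \<in> {0..1} \<Longrightarrow> v1 > 0 \<Longrightarrow> v2 > 0 \<Longrightarrow> v3 > 0 \<Longrightarrow>
          \<Phi> R v1 v2 v3 \<ge> \<phi>' v1 + \<phi>' v2 + \<phi>' v3 + h' (v1 * v2 * v3)" and
    lim: "filterlim (\<lambda>d. h' d / d) at_top at_top"
    using growth by (rule energy_growthE) (rule that)
  obtain d0 where d0: "\<And>d. d \<ge> d0 \<Longrightarrow> h' d / d \<ge> \<bar>N\<bar>"
    using lim unfolding filterlim_at_top eventually_at_top_linorder by blast
  have bnd: "h' d \<ge> N * d - \<bar>N\<bar> * \<bar>d0\<bar>" if "d > 0" for d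
  proof (cases "d \<ge> d0")
    case True
    have "\<bar>N\<bar> * d \<le> h' d" using d0[OF True] that by (simp add: field_simps)
    moreover have "N * d \<le> \<bar>N\<bar> * d" using that by (intro mult_right_mono) auto
    ultimately show ?thesis using mult_nonneg_nonneg[of "\<bar>N\<bar>" "\<bar>d0\<bar>"] by linarith
  next
    case False
    have "N * d \<le> \<bar>N\<bar> * d" using that by (intro mult_right_mono) auto
    also have "\<dots> \<le> \<bar>N\<bar> * \<bar>d0\<bar>" using False by (intro mult_left_mono) auto
    finally show ?thesis using h[OF that] by linarith
  qed
  show thesis
  proof (rule that[of "\<bar>N\<bar> * \<bar>d0\<bar>"])
    fix R v1 v2 v3 :: real assume v: "R \<in> {0..1}" "v1 > 0" "v2 > 0" "v3 > 0"
    then have "v1 * v2 * v3 > 0" by simp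
    then show "\<Phi> R v1 v2 v3 \<ge> N * (v1 * v2 * v3) - \<bar>N\<bar> * \<bar>d0\<bar>"
      using g[OF v] bnd[of "v1 * v2 * v3"] p[of v1] p[of v2] p[of v3] v by linarith
  qed simp
qed

lemma \<Phi>_pos:
  assumes "R \<in> {0..1}" "v1 > 0" "v2 > 0" "v3 > 0"
  shows "\<Phi> R v1 v2 v3 > 0"
proof -
  obtain \<phi>' h' where
    p: "\<And>v. v > 0 \<Longrightarrow> \<phi>' v > 0" and h: "\<And>d. d > 0 \<Longrightarrow> h' d > 0" and
    g: "\<And>R v1 v2 v3. R \<in> {0..1} \<Longrightarrow> v1 > 0 \<Longrightarrow> v2 > 0 \<Longrightarrow> v3 > 0 \<Longrightarrow>
          \<Phi> R v1 v2 v3 \<ge> \<phi>' v1 + \<phi>' v2 + \<phi>' v3 + h' (v1 * v2 * v3)" and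
    lim: "filterlim (\<lambda>d. h' d / d) at_top at_top"
    using growth by (rule energy_growthE) (rule that)
  have "v1 * v2 * v3 > 0" using assms by simp
  then show ?thesis
    using g[OF assms] p[of v1] p[of v2] p[of v3] h[of "v1 * v2 * v3"] assms by linarith
qed

lemma energy_density_nonneg:
  assumes "radial_pair s g" "R \<in> {0..1}"
  shows "energy_density \<Phi> s g R \<ge> 0"
proof (cases "R = 0")
  case False
  then have "s R > 0" "g R > 0" "R > 0"
    using assms radial_pair_pos[of s g R] radial_pair_deriv_pos[of s g R] by auto
  then show ?thesis
    using \<Phi>_pos[OF assms(2), of "g R" "s R / R" "s R / R"] by (simp add: energy_density_def less_imp_le)
qed simp

text \<open>The convex functions are continuous only on the open half-line. Cutting them off to zero
  elsewhere makes them Borel on the whole line, hence composable with the Lebesgue measurable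
  density \<open>g\<close>.\<close>

lemma energy_density_measurable:
  assumes sg: "radial_pair s g"
  shows "energy_density \<Phi> s g \<in> borel_measurable (lebesgue_on {0..1})"
proof -
  let ?M = "lebesgue_on {0..1::real}"
  define cut where "cut f x = indicator {0<..} x *\<^sub>R f x" for f :: "real \<Rightarrow> real" and x
  have cutm: "cut f \<in> borel_measurable borel" if "convex_on {0<..} f" for f
    unfolding cut_def[abs_def]
    by (rule borel_measurable_continuous_on_indicator) (auto intro!: convex_on_continuous that)
  note [measurable] = cutm[OF convex(1)] cutm[OF convex(2)] cutm[OF convex(3)]
  have cont: "f \<in> borel_measurable ?M" if "continuous_on {0..1} f" for f :: "real \<Rightarrow> real"
    using that by (intro continuous_imp_measurable_on_sets_lebesgue) auto
  have [measurable]: "s \<in> borel_measurable ?M" "\<alpha> \<in> borel_measurable ?M" "\<beta> \<in> borel_measurable ?M"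
    "\<gamma> \<in> borel_measurable ?M" "(\<lambda>R. R) \<in> borel_measurable ?M"
    using radial_pair_continuous[OF sg] cont_coeff by (auto intro!: cont continuous_intros)
  have [measurable]: "g \<in> borel_measurable ?M"
    using primitive_on_abs_integrable[OF radial_pair_primitive[OF sg]]
    by (rule absolutely_integrable_imp_borel_measurable) simp
  have "(\<lambda>R. (\<alpha> R * (cut \<phi> (g R) + cut \<phi> (s R / R) + cut \<phi> (s R / R)) +
     \<beta> R * (cut \<psi> (g R * (s R / R)) + cut \<psi> (g R * (s R / R)) + cut \<psi> (s R / R * (s R / R))) +
     \<gamma> R * cut h (g R * (s R / R) * (s R / R))) * R\<^sup>2) \<in> borel_measurable ?M" (is "?f \<in> _")
    by measurable
  moreover have "?f R = energy_density \<Phi> s g R" if "R \<in> {0..1}" for R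
  proof (cases "R = 0")
    case False
    then have "s R > 0" "g R > 0" "R > 0"
      using that radial_pair_pos[OF sg, of R] radial_pair_deriv_pos[OF sg, of R] by auto
    then show ?thesis by (simp add: cut_def energy_density_def stored_energy_def)
  qed simp
  ultimately show ?thesis
    by (subst measurable_cong[where g = ?f]) auto
qed

section \<open>Admissible maps in terms of positive densities\<close>

lemma I_mec_eq_nn_integral:
  assumes sg: "primitive_on 0 1 s g"
  shows "I_mec \<Phi> s = (\<integral>\<^sup>+R. ennreal (energy_density \<Phi> s g R) * indicator {0..1} R \<partial>lebesgue)"
proof -
  have "AE R in lebesgue. R \<noteq> (0::real)" "AE R in lebesgue. R \<noteq> (1::real)"
    by (auto intro!: AE_completion AE_lborel_singleton)
  moreover note weak_deriv_AE_eq[OF sg]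
  ultimately have "AE R in lebesgue. ennreal (\<Phi> R (weak_deriv s R) (s R / R) (s R / R) * R\<^sup>2) * indicator {0<..<1} R
     = ennreal (energy_density \<Phi> s g R) * indicator {0..1} R"
    by eventually_elim (auto simp: energy_density_def indicator_def)
  then show ?thesis
    unfolding I_mec_def by (rule nn_integral_cong_AE)
qed

lemma I_mec_eq_integral:
  assumes sg: "radial_pair s g" and int: "energy_density \<Phi> s g integrable_on {0..1}"
  shows "I_mec \<Phi> s = ennreal (integral {0..1} (energy_density \<Phi> s g))"
  using nn_integral_has_integral_lebesgue'[OF energy_density_nonneg[OF sg] integrable_integral[OF int]]
  by (simp add: I_mec_eq_nn_integral[OF radial_pair_primitive[OF sg]] nn_integral_completion)

lemma I_mec_finite_imp_integrable:
  assumes sg: "radial_pair s g" and fin: "I_mec \<Phi> s < \<infinity>"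
  shows "energy_density \<Phi> s g integrable_on {0..1}"
proof -
  let ?F = "\<lambda>R. if R \<in> {0..1} then energy_density \<Phi> s g R else 0"
  have m: "?F \<in> borel_measurable lebesgue"
    by (rule borel_measurable_if_I[OF energy_density_measurable[OF sg]]) simp
  have "(\<integral>\<^sup>+R. ennreal (?F R) \<partial>lebesgue) = I_mec \<Phi> s"
    unfolding I_mec_eq_nn_integral[OF radial_pair_primitive[OF sg]]
    by (intro nn_integral_cong) (auto simp: indicator_def)
  then obtain e where "e \<ge> 0" "(\<integral>\<^sup>+R. ennreal (?F R) \<partial>lebesgue) = ennreal e"
    using fin by (cases "I_mec \<Phi> s") auto
  then have "(?F has_integral e) UNIV"
    using m energy_density_nonneg[OF sg] by (subst has_integral_iff_nn_integral_lebesgue) auto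
  then show ?thesis
    unfolding has_integral_restrict_UNIV by (rule has_integral_integrable)
qed

lemma admissibleI:
  assumes sg: "radial_pair s g" and int: "energy_density \<Phi> s g integrable_on {0..1}" and "s 1 = lam"
  shows "s \<in> admissible \<Phi> lam"
  unfolding admissible_def mem_Collect_eq
proof (intro conjI)
  show "s \<in> W11" unfolding W11_iff_primitive_on by (rule exI, rule radial_pair_primitive[OF sg])
  show "AE R in lebesgue. R \<in> {0<..<1} \<longrightarrow> weak_deriv s R > 0"
    using weak_deriv_AE_eq[OF radial_pair_primitive[OF sg]]
    by eventually_elim (use radial_pair_deriv_pos[OF sg] in auto)
  show "I_mec \<Phi> s < \<infinity>" by (simp add: I_mec_eq_integral[OF sg int])
qed (use assms in \<open>auto simp: radial_pair_def\<close>)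

lemma admissibleE:
  assumes "s \<in> admissible \<Phi> lam"
  obtains g where "radial_pair s g" "energy_density \<Phi> s g integrable_on {0..1}"
proof -
  obtain g0 where g0: "primitive_on 0 1 s g0"
    using assms unfolding admissible_def mem_Collect_eq W11_iff_primitive_on by (elim conjE exE)
  \<comment> \<open>The value 1 is substituted at the endpoints and wherever \<open>g0\<close> fails
    to be positive, which is a null set; the result is still a density of \<open>s\<close>.\<close>
  define g where "g R = (if R \<in> {0<..<1} \<and> g0 R > 0 then g0 R else 1)" for R
  have "AE R in lebesgue. R \<in> {0<..<1} \<longrightarrow> weak_deriv s R > 0"
    using assms by (simp add: admissible_def)
  moreover have "AE R in lebesgue. R \<noteq> (0::real)" "AE R in lebesgue. R \<noteq> (1::real)"
    by (auto intro!: AE_completion AE_lborel_singleton)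
  moreover note weak_deriv_AE_eq[OF g0]
  ultimately have "AE R in lebesgue. R \<in> {0..1} \<longrightarrow> g0 R = g R"
    by eventually_elim (auto simp: g_def)
  then have "primitive_on 0 1 s g" by (rule primitive_on_AE_cong[OF g0])
  then have sg: "radial_pair s g"
    using assms by (auto simp: radial_pair_def g_def admissible_def)
  have "I_mec \<Phi> s < \<infinity>" using assms by (simp add: admissible_def)
  then show thesis
    using sg by (intro that I_mec_finite_imp_integrable)
qed

end

section \<open>Jensen inequality for the frozen energy\<close>

lemma stored_energy_frozen:
  "stored_energy (\<lambda>_. \<alpha> 0) (\<lambda>_. \<beta> 0) (\<lambda>_. \<gamma> 0) \<phi> \<psi> h = (\<lambda>_. stored_energy \<alpha> \<beta> \<gamma> \<phi> \<psi> h 0)"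
  by (simp add: fun_eq_iff stored_energy_def)

lemma energy_growth_frozen:
  assumes "energy_growth \<Phi>"
  shows "energy_growth (\<lambda>_. \<Phi> 0)"
  using assms unfolding energy_growth_def
  by (elim ex_forward conjE, intro conjI) (assumption | simp)+

lemma continuous_relative_error:
  assumes f: "continuous_on {0..1} f" and "f 0 > (0::real)" "\<omega> > 0"
  obtains e where "0 < e" "e \<le> (1::real)" "\<And>R. 0 \<le> R \<Longrightarrow> R \<le> e \<Longrightarrow> \<bar>f R - f 0\<bar> \<le> \<omega> * f 0"
proof -
  have "\<omega> * f 0 > 0" using assms by simp
  then obtain d where d: "d > 0" "\<And>R. R \<in> {0..1} \<Longrightarrow> dist R 0 < d \<Longrightarrow> dist (f R) (f 0) < \<omega> * f 0"
    using f unfolding continuous_on_iff by (metis atLeastAtMost_iff order_refl zero_le_one)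
  show thesis
  proof (rule that[of "min 1 (d / 2)"])
    show "\<bar>f R - f 0\<bar> \<le> \<omega> * f 0" if "0 \<le> R" "R \<le> min 1 (d / 2)" for R
      using d(2)[of R] that d(1) by (auto simp: dist_real_def)
  qed (use d(1) in auto)
qed

text \<open>Its derivative is \<open>R\<^sup>2\<close> times the affine function of the elementary symmetric functions of the
  stretches \<open>s', s/R, s/R\<close> with coefficients \<open>a, b, c\<close> that vanishes when all stretches equal \<open>m\<close>.\<close>

definition null_lagrangian :: "real \<Rightarrow> real \<Rightarrow> real \<Rightarrow> real \<Rightarrow> (real \<Rightarrow> real) \<Rightarrow> real \<Rightarrow> real" where
  "null_lagrangian a b c m s R =
     a * (R^2 * s R - m * R^3) + b * (R * s R^2 - m^2 * R^3) + c * (s R^3 - m^3 * R^3) / 3"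

lemma null_lagrangian_eq_0:
  assumes "R > 0"
  shows "null_lagrangian a b c (s R / R) s R = 0"
  using assms by (simp add: null_lagrangian_def field_simps power2_eq_square power3_eq_cube)

text \<open>The bracket is the affine part of the tangent inequality at three equal stretches
  \<open>s R / R\<close>. Boundary terms can therefore be estimated by differences of homogeneous
  energies.\<close>

lemma null_lagrangian_scale:
  assumes "R > 0"
  shows "null_lagrangian a b c m s R = R^3 / 3 * (a * (3 * (s R / R) - 3 * m)
     + b * (3 * (s R / R)^2 - 3 * m^2) + c * ((s R / R)^3 - m^3))"
  using assms by (simp add: null_lagrangian_def field_simps power2_eq_square power3_eq_cube)

text \<open>Since \<open>s\<close> is only absolutely continuous, the expression is expanded into
  the products \<open>R^2 * s\<close>, \<open>R * s^2\<close>, \<open>s^3\<close> and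
  \<open>R^3\<close>, to which the product rule applies.\<close>

lemma primitive_on_null_lagrangian:
  assumes s: "primitive_on 0 1 s g"
  shows "primitive_on 0 1 (null_lagrangian a b c m s)
    (\<lambda>R. a * (R^2 * g R + 2 * R * s R - 3 * m * R^2) + b * (2 * R * s R * g R + s R^2 - 3 * m^2 * R^2)
       + c * (s R^2 * g R - m^3 * R^2))"
proof -
  have R: "primitive_on 0 1 (\<lambda>R. R) (\<lambda>_. 1)"
    by (rule primitive_on_C1) (auto intro!: derivative_eq_intros)
  note RR = primitive_on_mult[OF R R]
  note ss = primitive_on_mult[OF s s]
  note t1 = primitive_on_mult[OF RR s] and t2 = primitive_on_mult[OF R ss]
    and t3 = primitive_on_mult[OF s ss] and t4 = primitive_on_mult[OF R RR]
  note T = primitive_on_add[OF primitive_on_cmult[OF t1, of a]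
    primitive_on_add[OF primitive_on_cmult[OF t2, of b]
    primitive_on_add[OF primitive_on_cmult[OF t3, of "c / 3"]
      primitive_on_cmult[OF t4, of "- (a * m + b * m^2 + c * m^3 / 3)"]]]]
  show ?thesis
    by (rule back_subst[where P = "\<lambda>u. primitive_on 0 1 u _",
          OF back_subst[where P = "\<lambda>k. primitive_on 0 1 _ k", OF T]])
      (auto simp: fun_eq_iff null_lagrangian_def algebra_simps power2_eq_square power3_eq_cube diff_divide_distrib)
qed

context radial_energy
begin

text \<open>The error in \<gamma> multiplies \<open>|h|\<close>, and \<open>h\<close> may be
  negative. A supporting line bounds its negative part linearly in the determinant, and superlinear
  growth bounds the determinant by the energy itself, so all errors are relative to
  \<open>\<Phi> 0 + 1\<close>.\<close>

lemma frozen_perturbation: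
  assumes "\<eta> > 0"
  obtains e where "0 < e" "e \<le> 1"
    "\<And>R v1 v2 v3. 0 \<le> R \<Longrightarrow> R \<le> e \<Longrightarrow> v1 > 0 \<Longrightarrow> v2 > 0 \<Longrightarrow> v3 > 0 \<Longrightarrow>
       \<bar>\<Phi> R v1 v2 v3 - \<Phi> 0 v1 v2 v3\<bar> \<le> \<eta> * (\<Phi> 0 v1 v2 v3 + 1)"
proof -
  obtain D where D: "D \<ge> 0"
    "\<And>R v1 v2 v3. R \<in> {0..1} \<Longrightarrow> v1 > 0 \<Longrightarrow> v2 > 0 \<Longrightarrow> v3 > 0 \<Longrightarrow> \<Phi> R v1 v2 v3 \<ge> 1 * (v1 * v2 * v3) - D"
    by (rule superlinear_det[of 1]) (rule that)
  obtain m where m: "\<And>y. y > 0 \<Longrightarrow> h y \<ge> h 1 + m * (y - 1)"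
    by (rule convex_tangent[OF convex(3) zero_less_one]) (rule that)
  define H where "H = \<bar>h 1\<bar> + \<bar>m\<bar>"
  have hb: "h y \<ge> - H * (1 + y)" if "y > 0" for y
  proof -
    have "m * y \<ge> - \<bar>m\<bar> * y" using that by (intro mult_right_mono) auto
    moreover have "0 \<le> \<bar>h 1\<bar> * y" using that by simp
    ultimately show ?thesis using m[OF that] by (simp add: H_def algebra_simps)
  qed
  \<comment> \<open>The factor comes from \<open>1 + \<Phi> 0 v1 v2 v3 + D <= (1 + D) * (\<Phi> 0 v1
    v2 v3 + 1)\<close>, applied to the estimate of \<open>|h d|\<close>.\<close>
  define M where "M = 1 + 2 * \<gamma> 0 * H * (1 + D)"
  have pos0: "\<alpha> 0 > 0" "\<beta> 0 > 0" "\<gamma> 0 > 0" using pos_coeff[of 0] by auto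
  have H0: "H \<ge> 0" by (simp add: H_def)
  have M1: "M \<ge> 1" using pos0 H0 D(1) by (simp add: M_def)
  define \<omega> where "\<omega> = \<eta> / M"
  have \<omega>: "\<omega> > 0" using M1 assms by (simp add: \<omega>_def)
  obtain e1 where e1: "0 < e1" "e1 \<le> 1" "\<And>R. 0 \<le> R \<Longrightarrow> R \<le> e1 \<Longrightarrow> \<bar>\<alpha> R - \<alpha> 0\<bar> \<le> \<omega> * \<alpha> 0"
    by (rule continuous_relative_error[OF cont_coeff(1) pos0(1) \<omega>]) (rule that)
  obtain e2 where e2: "0 < e2" "e2 \<le> 1" "\<And>R. 0 \<le> R \<Longrightarrow> R \<le> e2 \<Longrightarrow> \<bar>\<beta> R - \<beta> 0\<bar> \<le> \<omega> * \<beta> 0"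
    by (rule continuous_relative_error[OF cont_coeff(2) pos0(2) \<omega>]) (rule that)
  obtain e3 where e3: "0 < e3" "e3 \<le> 1" "\<And>R. 0 \<le> R \<Longrightarrow> R \<le> e3 \<Longrightarrow> \<bar>\<gamma> R - \<gamma> 0\<bar> \<le> \<omega> * \<gamma> 0"
    by (rule continuous_relative_error[OF cont_coeff(3) pos0(3) \<omega>]) (rule that)
  show thesis
  proof (rule that[of "min e1 (min e2 e3)"])
    fix R v1 v2 v3 :: real
    assume R: "0 \<le> R" "R \<le> min e1 (min e2 e3)" and v: "v1 > 0" "v2 > 0" "v3 > 0"
    define p where "p = \<phi> v1 + \<phi> v2 + \<phi> v3"
    define q where "q = \<psi> (v1 * v2) + \<psi> (v1 * v3) + \<psi> (v2 * v3)"
    define d where "d = v1 * v2 * v3"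
    have d: "d > 0" using v by (simp add: d_def)
    have pq: "p \<ge> 0" "q \<ge> 0"
      using v by (auto simp: p_def q_def intro!: add_nonneg_nonneg nonneg)
    have \<Phi>: "\<Phi> R v1 v2 v3 = \<alpha> R * p + \<beta> R * q + \<gamma> R * h d" for R
      by (simp add: stored_energy_def p_def q_def d_def)
    have P0: "\<Phi> 0 v1 v2 v3 > 0" using \<Phi>_pos[of 0] v by simp
    have dP: "d \<le> \<Phi> 0 v1 v2 v3 + D" using D(2)[of 0 v1 v2 v3] v by (simp add: d_def)
    \<comment> \<open>The absolute value is \<open>h d\<close> plus twice its negative part, and
      \<open>hb\<close> bounds that part by \<open>H * (1 + d)\<close>.\<close>
    have "\<bar>h d\<bar> \<le> h d + 2 * H * (1 + d)" using hb[OF d] H0 d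
      by (auto simp: abs_if algebra_simps intro!: add_nonneg_nonneg mult_nonneg_nonneg)
    then have "\<gamma> 0 * \<bar>h d\<bar> \<le> \<gamma> 0 * h d + \<gamma> 0 * (2 * H * (1 + d))"
      using pos0 by (metis distrib_left mult_left_mono less_imp_le)
    also have "\<gamma> 0 * (2 * H * (1 + d)) \<le> \<gamma> 0 * (2 * H * (1 + (\<Phi> 0 v1 v2 v3 + D)))"
      using pos0 H0 dP by (intro mult_left_mono) auto
    finally have "\<alpha> 0 * p + \<beta> 0 * q + \<gamma> 0 * \<bar>h d\<bar> \<le> \<Phi> 0 v1 v2 v3 + \<gamma> 0 * (2 * H * (1 + (\<Phi> 0 v1 v2 v3 + D)))"
      by (simp add: \<Phi>)
    also have "\<dots> \<le> M * (\<Phi> 0 v1 v2 v3 + 1)"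
    proof -
      have "0 \<le> 2 * \<gamma> 0 * H * (D * \<Phi> 0 v1 v2 v3)"
        using pos0 H0 D(1) P0 by simp
      then show ?thesis by (simp add: M_def algebra_simps)
    qed
    finally have S: "\<alpha> 0 * p + \<beta> 0 * q + \<gamma> 0 * \<bar>h d\<bar> \<le> M * (\<Phi> 0 v1 v2 v3 + 1)" .
    have "\<bar>\<Phi> R v1 v2 v3 - \<Phi> 0 v1 v2 v3\<bar>
        = \<bar>(\<alpha> R - \<alpha> 0) * p + (\<beta> R - \<beta> 0) * q + (\<gamma> R - \<gamma> 0) * h d\<bar>"
      by (simp add: \<Phi> algebra_simps)
    also have "\<dots> \<le> \<bar>\<alpha> R - \<alpha> 0\<bar> * p + \<bar>\<beta> R - \<beta> 0\<bar> * q + \<bar>\<gamma> R - \<gamma> 0\<bar> * \<bar>h d\<bar>"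
      using pq by (auto simp: abs_mult intro!: order_trans[OF abs_triangle_ineq] add_mono)
    also have "\<dots> \<le> \<omega> * \<alpha> 0 * p + \<omega> * \<beta> 0 * q + \<omega> * \<gamma> 0 * \<bar>h d\<bar>"
      using e1(3)[of R] e2(3)[of R] e3(3)[of R] R pq by (intro add_mono mult_right_mono) auto
    also have "\<dots> = \<omega> * (\<alpha> 0 * p + \<beta> 0 * q + \<gamma> 0 * \<bar>h d\<bar>)" by (simp add: algebra_simps)
    also have "\<dots> \<le> \<omega> * (M * (\<Phi> 0 v1 v2 v3 + 1))" using S \<omega> by (intro mult_left_mono) auto
    also have "\<dots> = \<eta> * (\<Phi> 0 v1 v2 v3 + 1)" using M1 by (simp add: \<omega>_def)
    finally show "\<bar>\<Phi> R v1 v2 v3 - \<Phi> 0 v1 v2 v3\<bar> \<le> \<eta> * (\<Phi> 0 v1 v2 v3 + 1)" .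
  qed (use e1 e2 e3 in auto)
qed

text \<open>Polyconvexity: supporting lines of \<phi>, \<psi>, \<open>h\<close> at \<open>m\<close>,
  \<open>m^2\<close>, \<open>m^3\<close> add up to an affine function of the elementary symmetric
  functions of the stretches.\<close>

lemma frozen_tangent:
  assumes m: "m > 0"
  obtains a b c where "\<And>v1 v2 v3. v1 > 0 \<Longrightarrow> v2 > 0 \<Longrightarrow> v3 > 0 \<Longrightarrow>
    \<Phi> 0 v1 v2 v3 \<ge> \<Phi> 0 m m m + a * (v1 + v2 + v3 - 3 * m)
       + b * (v1 * v2 + v1 * v3 + v2 * v3 - 3 * m^2) + c * (v1 * v2 * v3 - m^3)"
proof -
  obtain a where a: "\<And>y. y > 0 \<Longrightarrow> \<phi> y \<ge> \<phi> m + a * (y - m)"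
    by (rule convex_tangent[OF convex(1) m]) (rule that)
  obtain b where b: "\<And>y. y > 0 \<Longrightarrow> \<psi> y \<ge> \<psi> (m * m) + b * (y - m * m)"
    by (rule convex_tangent[OF convex(2), of "m * m"]) (use m that in auto)
  obtain c where c: "\<And>y. y > 0 \<Longrightarrow> h y \<ge> h (m * m * m) + c * (y - m * m * m)"
    by (rule convex_tangent[OF convex(3), of "m * m * m"]) (use m that in auto)
  have pos0: "\<alpha> 0 > 0" "\<beta> 0 > 0" "\<gamma> 0 > 0" using pos_coeff[of 0] by auto
  show thesis
  proof (rule that[of "\<alpha> 0 * a" "\<beta> 0 * b" "\<gamma> 0 * c"])
    fix v1 v2 v3 :: real assume v: "v1 > 0" "v2 > 0" "v3 > 0"
    have "\<alpha> 0 * (\<phi> v1 + \<phi> v2 + \<phi> v3) \<ge> \<alpha> 0 * (3 * \<phi> m + a * (v1 + v2 + v3 - 3 * m))"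
      using a[OF v(1)] a[OF v(2)] a[OF v(3)] pos0 by (intro mult_left_mono) (auto simp: algebra_simps)
    moreover have "\<beta> 0 * (\<psi> (v1 * v2) + \<psi> (v1 * v3) + \<psi> (v2 * v3)) \<ge>
       \<beta> 0 * (3 * \<psi> (m * m) + b * (v1 * v2 + v1 * v3 + v2 * v3 - 3 * m^2))"
      using b[of "v1 * v2"] b[of "v1 * v3"] b[of "v2 * v3"] v pos0
      by (intro mult_left_mono) (auto simp: algebra_simps power2_eq_square)
    moreover have "\<gamma> 0 * h (v1 * v2 * v3) \<ge> \<gamma> 0 * (h (m * m * m) + c * (v1 * v2 * v3 - m^3))"
      using c[of "v1 * v2 * v3"] v pos0
      by (intro mult_left_mono) (auto simp: power3_eq_cube)
    ultimately show "\<Phi> 0 v1 v2 v3 \<ge> \<Phi> 0 m m m + \<alpha> 0 * a * (v1 + v2 + v3 - 3 * m)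
       + \<beta> 0 * b * (v1 * v2 + v1 * v3 + v2 * v3 - 3 * m^2) + \<gamma> 0 * c * (v1 * v2 * v3 - m^3)"
      by (simp add: stored_energy_def algebra_simps)
  qed
qed

text \<open>The tangent inequality along \<open>s\<close>, with an explicit integral because its
  affine part is a null Lagrangian. The last claim concerns the same \<open>a\<close>,
  \<open>b\<close>, \<open>c\<close> and serves to estimate the boundary terms.\<close>

lemma frozen_lower_bound:
  assumes sg: "radial_pair s g" and m: "m > 0"
  obtains a b c L where
    "\<And>x y. 0 \<le> x \<Longrightarrow> x \<le> y \<Longrightarrow> y \<le> 1 \<Longrightarrow>
       (L has_integral \<Phi> 0 m m m * (y^3 - x^3) / 3
          + (null_lagrangian a b c m s y - null_lagrangian a b c m s x)) {x..y}"
    "\<And>R. 0 \<le> R \<Longrightarrow> R \<le> 1 \<Longrightarrow> L R \<le> energy_density (\<lambda>_. \<Phi> 0) s g R"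
    "\<And>v. v > 0 \<Longrightarrow> \<Phi> 0 v v v \<ge> \<Phi> 0 m m m + a * (3 * v - 3 * m) + b * (3 * v^2 - 3 * m^2) + c * (v^3 - m^3)"
proof -
  obtain a b c where T: "\<And>v1 v2 v3. v1 > 0 \<Longrightarrow> v2 > 0 \<Longrightarrow> v3 > 0 \<Longrightarrow>
    \<Phi> 0 v1 v2 v3 \<ge> \<Phi> 0 m m m + a * (v1 + v2 + v3 - 3 * m)
       + b * (v1 * v2 + v1 * v3 + v2 * v3 - 3 * m^2) + c * (v1 * v2 * v3 - m^3)"
    by (rule frozen_tangent[OF m]) (rule that)
  define K where "K R = a * (R^2 * g R + 2 * R * s R - 3 * m * R^2)
       + b * (2 * R * s R * g R + s R^2 - 3 * m^2 * R^2) + c * (s R^2 * g R - m^3 * R^2)" for R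
  have K: "primitive_on 0 1 (null_lagrangian a b c m s) K"
    using primitive_on_null_lagrangian[OF radial_pair_primitive[OF sg]] by (simp add: K_def[abs_def])
  \<comment> \<open>With a cavity \<open>K 0\<close> need not vanish, whereas the energy density is
    0 at the origin; hence the separate value.\<close>
  define L where "L R = (if R = 0 then 0 else \<Phi> 0 m m m * R^2 + K R)" for R
  show thesis
  proof (rule that[of L a b c])
    fix x y :: real assume xy: "0 \<le> x" "x \<le> y" "y \<le> 1"
    have "((\<lambda>R. \<Phi> 0 m m m * R^2) has_integral \<Phi> 0 m m m * y^3 / 3 - \<Phi> 0 m m m * x^3 / 3) {x..y}"
      using xy(2)
      by (intro fundamental_theorem_of_calculus)
        (auto intro!: derivative_eq_intros simp: power2_eq_square simp flip: has_real_derivative_iff_has_vector_derivative)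
    from has_integral_add[OF this primitive_on_has_integral[OF K xy]]
    have "((\<lambda>R. \<Phi> 0 m m m * R^2 + K R) has_integral \<Phi> 0 m m m * (y^3 - x^3) / 3
          + (null_lagrangian a b c m s y - null_lagrangian a b c m s x)) {x..y}"
      by (simp add: algebra_simps diff_divide_distrib)
    then show "(L has_integral \<Phi> 0 m m m * (y^3 - x^3) / 3
          + (null_lagrangian a b c m s y - null_lagrangian a b c m s x)) {x..y}"
      by (rule has_integral_spike_finite[of "{0}", rotated 2]) (auto simp: L_def)
  next
    fix R :: real assume R: "0 \<le> R" "R \<le> 1"
    show "L R \<le> energy_density (\<lambda>_. \<Phi> 0) s g R"
    proof (cases "R = 0")
      case False
      then have p: "R > 0" "s R / R > 0" "g R > 0"
        using R radial_pair_pos[OF sg, of R] radial_pair_deriv_pos[OF sg, of R] by auto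
      have "L R = (\<Phi> 0 m m m + a * (g R + s R / R + s R / R - 3 * m)
       + b * (g R * (s R / R) + g R * (s R / R) + (s R / R) * (s R / R) - 3 * m^2)
       + c * (g R * (s R / R) * (s R / R) - m^3)) * R^2"
        using p(1) by (simp add: L_def K_def field_simps power2_eq_square)
      also have "\<dots> \<le> energy_density (\<lambda>_. \<Phi> 0) s g R"
        unfolding energy_density_def by (intro mult_right_mono T p) simp
      finally show ?thesis .
    qed (simp add: L_def)
  next
    fix v :: real assume "v > 0"
    from T[OF this this this] 
    show "\<Phi> 0 v v v \<ge> \<Phi> 0 m m m + a * (3 * v - 3 * m) + b * (3 * v^2 - 3 * m^2) + c * (v^3 - m^3)"
      by (simp add: power2_eq_square power3_eq_cube)
  qed
qed

text \<open>The tangent is taken at the slope \<open>s e / e\<close>, which kills the boundary term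
  at \<open>e\<close>. The one at 0 equals \<open>c * s 0 ^ 3 / 3\<close>, so it disappears exactly
  because there is no cavity.\<close>

lemma no_cavity_lower_bound:
  assumes sg: "radial_pair s g" and s0: "s 0 = 0" and e: "0 < e" "e \<le> 1"
  obtains L where "(L has_integral e^3 * \<Phi> 0 (s e / e) (s e / e) (s e / e) / 3) {0..e}"
    "\<And>R. 0 \<le> R \<Longrightarrow> R \<le> e \<Longrightarrow> L R \<le> energy_density (\<lambda>_. \<Phi> 0) s g R"
proof -
  have m: "s e / e > 0" using radial_pair_pos[OF sg] e by simp
  obtain a b c L where L:
    "\<And>x y. 0 \<le> x \<Longrightarrow> x \<le> y \<Longrightarrow> y \<le> 1 \<Longrightarrow>
       (L has_integral \<Phi> 0 (s e / e) (s e / e) (s e / e) * (y^3 - x^3) / 3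
          + (null_lagrangian a b c (s e / e) s y - null_lagrangian a b c (s e / e) s x)) {x..y}"
    "\<And>R. 0 \<le> R \<Longrightarrow> R \<le> 1 \<Longrightarrow> L R \<le> energy_density (\<lambda>_. \<Phi> 0) s g R"
    by (rule frozen_lower_bound[OF sg m]) (rule that)
  show thesis
  proof (rule that[of L])
    show "(L has_integral e^3 * \<Phi> 0 (s e / e) (s e / e) (s e / e) / 3) {0..e}"
      using L(1)[of 0 e] e s0 by (simp add: null_lagrangian_eq_0 mult.commute) (simp add: null_lagrangian_def)
    show "L R \<le> energy_density (\<lambda>_. \<Phi> 0) s g R" if "0 \<le> R" "R \<le> e" for R
      using L(2)[of R] that e by simp
  qed
qed

text \<open>Replacing \<open>s\<close> on \<open>[0,d]\<close> by the homogeneous map with the same boundary value removes the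
  cavity, so the result has at least the energy of the homogeneous map of slope \<open>s 1\<close>. Hence the
  energy gain of \<open>s\<close> over the homogeneous map is already realised on every \<open>[0,d]\<close>.\<close>

lemma inner_energy_gap:
  assumes sg: "radial_pair s g" and int: "energy_density (\<lambda>_. \<Phi> 0) s g integrable_on {0..1}"
    and d: "0 < d" "d \<le> 1"
  shows "integral {0..d} (energy_density (\<lambda>_. \<Phi> 0) s g) \<le> d^3 * \<Phi> 0 (s d / d) (s d / d) (s d / d) / 3
     - (\<Phi> 0 (s 1) (s 1) (s 1) / 3 - integral {0..1} (energy_density (\<lambda>_. \<Phi> 0) s g))"
proof -
  let ?F = "energy_density (\<lambda>_. \<Phi> 0) s g" and ?P = "\<lambda>m. \<Phi> 0 m m m"
  have m: "s 1 > 0" "s d / d > 0" using radial_pair_pos[OF sg] d by auto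
  obtain a b c L where L:
    "\<And>x y. 0 \<le> x \<Longrightarrow> x \<le> y \<Longrightarrow> y \<le> 1 \<Longrightarrow>
       (L has_integral \<Phi> 0 (s 1) (s 1) (s 1) * (y^3 - x^3) / 3
          + (null_lagrangian a b c (s 1) s y - null_lagrangian a b c (s 1) s x)) {x..y}"
    "\<And>R. 0 \<le> R \<Longrightarrow> R \<le> 1 \<Longrightarrow> L R \<le> ?F R"
    "\<And>v. v > 0 \<Longrightarrow> \<Phi> 0 v v v \<ge> \<Phi> 0 (s 1) (s 1) (s 1) + a * (3 * v - 3 * s 1) + b * (3 * v^2 - 3 * s 1^2) + c * (v^3 - s 1^3)"
    by (rule frozen_lower_bound[OF sg m(1)]) (rule that)
  have int': "?F integrable_on {x..y}" if "0 \<le> x" "y \<le> 1" for x y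
    using int that by (intro integrable_on_subinterval[OF int]) auto
  \<comment> \<open>With the tangent at slope \<open>s 1\<close> the boundary term vanishes at 1 and
    only the one at \<open>d\<close> is left; the replaced map itself never has to be
    constructed.\<close>
  have "?P (s 1) * (1 - d^3) / 3 - null_lagrangian a b c (s 1) s d \<le> integral {d..1} ?F"
  proof (rule has_integral_le)
    show "(?F has_integral integral {d..1} ?F) {d..1}"
      using int'[of d 1] d by (simp add: integrable_integral)
    show "(L has_integral ?P (s 1) * (1 - d^3) / 3 - null_lagrangian a b c (s 1) s d) {d..1}"
      using L(1)[of d 1] d null_lagrangian_eq_0[of 1 a b c s] by simp
  qed (use L(2) d in auto)
  \<comment> \<open>The remaining boundary term is the affine part at equal stretches
    \<open>s d / d\<close>, so the tangent inequality there bounds it.\<close>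
  moreover have "null_lagrangian a b c (s 1) s d \<le> d^3 / 3 * (?P (s d / d) - ?P (s 1))"
    unfolding null_lagrangian_scale[OF d(1)] using L(3)[OF m(2)] d by (intro mult_left_mono) auto
  moreover have "integral {0..d} ?F + integral {d..1} ?F = integral {0..1} ?F"
    using d by (intro Henstock_Kurzweil_Integration.integral_combine int') auto
  ultimately show ?thesis by (simp add: algebra_simps diff_divide_distrib)
qed

text \<open>Contraposition of the no-cavity bound on the whole interval. Beating the homogeneous map
  thus already provides the cavity that \<open>matching_radius\<close> relies on.\<close>

lemma cavity_if_energy_gap:
  assumes sg: "radial_pair s g" and int: "energy_density (\<lambda>_. \<Phi> 0) s g integrable_on {0..1}"
    and gap: "integral {0..1} (energy_density (\<lambda>_. \<Phi> 0) s g) < \<Phi> 0 (s 1) (s 1) (s 1) / 3"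
  shows "s 0 > 0"
proof (rule ccontr)
  assume "\<not> s 0 > 0"
  then have "s 0 = 0" using sg by (auto simp: radial_pair_def)
  then obtain L where L: "(L has_integral 1^3 * \<Phi> 0 (s 1 / 1) (s 1 / 1) (s 1 / 1) / 3) {0..1}"
    "\<And>R. 0 \<le> R \<Longrightarrow> R \<le> 1 \<Longrightarrow> L R \<le> energy_density (\<lambda>_. \<Phi> 0) s g R"
    by (rule no_cavity_lower_bound[OF sg _ zero_less_one order_refl]) (rule that)
  have "1^3 * \<Phi> 0 (s 1 / 1) (s 1 / 1) (s 1 / 1) / 3 \<le> integral {0..1} (energy_density (\<lambda>_. \<Phi> 0) s g)"
    by (rule has_integral_le[OF L(1) integrable_integral[OF int]]) (use L(2) in auto)
  then show False using gap by simp
qed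

end

section \<open>Competitors with a cavity\<close>

lemma has_integral_scale:
  fixes f :: "real \<Rightarrow> real"
  assumes "(f has_integral i) {0..c * x}" "c > 0"
  shows "((\<lambda>t. f (c * t)) has_integral i / c) {0..x}"
  using has_integral_affinity'[of f i 0 "c * x" c 0] assms by (simp add: field_simps)

lemma has_integral_square:
  fixes x :: real
  assumes "0 \<le> x"
  shows "((\<lambda>t. t^2) has_integral x^3 / 3) {0..x}"
proof -
  have "((\<lambda>t. t^2) has_integral x^3 / 3 - 0^3 / 3) {0..x}"
    using assms
    by (intro fundamental_theorem_of_calculus)
      (auto intro!: derivative_eq_intros simp: power2_eq_square simp flip: has_real_derivative_iff_has_vector_derivative)
  then show ?thesis by simp
qed

definition splice :: "real \<Rightarrow> real \<Rightarrow> (real \<Rightarrow> real) \<Rightarrow> (real \<Rightarrow> real) \<Rightarrow> real \<Rightarrow> real" where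
  "splice e d s r x = (if x \<le> e then e / d * s (d / e * x) else r x)"

text \<open>On the inner part the factors \<open>e / d\<close> and \<open>d / e\<close> of the chain
  rule cancel.\<close>

definition splice_deriv :: "real \<Rightarrow> real \<Rightarrow> (real \<Rightarrow> real) \<Rightarrow> (real \<Rightarrow> real) \<Rightarrow> real \<Rightarrow> real" where
  "splice_deriv e d k g x = (if x \<le> e then k (d / e * x) else g x)"

lemma splice_outer:
  assumes "0 < e" "0 < d" "s d / d = r e / e" "e \<le> R"
  shows "splice e d s r R = r R"
  using assms by (cases "R = e") (auto simp: splice_def field_simps)

lemma radial_pair_splice:
  assumes s: "radial_pair s k" and r: "radial_pair r g"
    and e: "0 < e" "e \<le> 1" and d: "0 < d" "d \<le> 1" and eq: "s d / d = r e / e"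
  shows "radial_pair (splice e d s r) (splice_deriv e d k g)"
proof -
  let ?t = "splice e d s r" and ?t' = "splice_deriv e d k g"
  have de: "0 < d / e" using e d by simp
  have sub: "d / e * x \<le> d" if "x \<le> e" for x
    using mult_left_mono[OF that, of "d / e"] e d by simp
  have pos: "?t' x > 0" if "0 \<le> x" "x \<le> 1" for x
  proof (cases "x \<le> e")
    case True
    have "0 \<le> d / e * x" using mult_nonneg_nonneg[OF less_imp_le[OF de] that(1)] .
    then show ?thesis
      using True sub[OF True] d radial_pair_deriv_pos[OF s, of "d / e * x"] by (simp add: splice_deriv_def)
  qed (use radial_pair_deriv_pos[OF r] that in \<open>simp add: splice_deriv_def\<close>)
  have inner: "(?t' has_integral (?t x - ?t 0)) {0..x}" if x: "0 \<le> x" "x \<le> e" for x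
  proof -
    have dx: "0 \<le> d / e * x" using mult_nonneg_nonneg[OF less_imp_le[OF de] x(1)] .
    have "(k has_integral (s (d / e * x) - s 0)) {0..d / e * x}"
      using primitive_on_has_integral[OF radial_pair_primitive[OF s] order_refl dx] sub[OF x(2)] d by simp
    from has_integral_scale[OF this de]
    have "((\<lambda>t. k (d / e * t)) has_integral (?t x - ?t 0)) {0..x}"
      using x e d by (simp add: splice_def field_simps)
    then show ?thesis
      by (rule has_integral_eq[rotated]) (use x in \<open>auto simp: splice_deriv_def\<close>)
  qed
  have full: "(?t' has_integral (?t x - ?t 0)) {0..x}" if x: "0 \<le> x" "x \<le> 1" for x
  proof (cases "x \<le> e")
    case False
    have "(g has_integral (r x - r e)) {e..x}"
      using primitive_on_has_integral[OF radial_pair_primitive[OF r], of e x] e x False by simp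
    then have "(?t' has_integral (r x - r e)) {e..x}"
      by (rule has_integral_spike_finite[of "{e}", rotated 2]) (auto simp: splice_deriv_def)
    from has_integral_combine[OF _ _ inner[of e] this]
    have "(?t' has_integral (?t e - ?t 0 + (r x - r e))) {0..x}" using e False by simp
    then show ?thesis
      using splice_outer[of e d s r e] splice_outer[of e d s r x] e d eq False by simp
  qed (use inner x in simp)
  \<comment> \<open>The sign of the density upgrades the integrability obtained by gluing to
    absolute integrability.\<close>
  have "?t' absolutely_integrable_on {0..1}"
  proof (rule nonnegative_absolutely_integrable_1)
    show "?t' integrable_on {0..1}" using full[of 1] by (simp add: has_integral_integrable)
    show "0 \<le> ?t' x" if "x \<in> {0..1}" for x using pos[of x] that by simp
  qed
  then have "primitive_on 0 1 ?t ?t'" using full by (rule primitive_onI)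
  moreover have "?t 0 \<ge> 0" using s e d by (simp add: splice_def radial_pair_def)
  ultimately show ?thesis using pos by (simp add: radial_pair_def)
qed

context radial_energy
begin

text \<open>The stretches at \<open>R\<close> are those of \<open>s\<close> at
  \<open>d / e * R\<close>; the weight contributes \<open>(e / d)^2\<close> and the substitution one
  more factor \<open>e / d\<close>.\<close>

lemma frozen_energy_splice:
  assumes int: "energy_density (\<lambda>_. \<Phi> 0) s k integrable_on {0..d}" and e: "0 < e" and d: "0 < d"
  shows "(energy_density (\<lambda>_. \<Phi> 0) (splice e d s r) (splice_deriv e d k g) has_integral
     (e / d)^3 * integral {0..d} (energy_density (\<lambda>_. \<Phi> 0) s k)) {0..e}"
proof -
  let ?F = "energy_density (\<lambda>_. \<Phi> 0) s k"
  have "(?F has_integral integral {0..d} ?F) {0..d / e * e}"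
    using int e by (simp add: integrable_integral)
  from has_integral_mult_right[OF has_integral_scale[OF this], of "(e / d)^2"]
  have "((\<lambda>R. (e / d)^2 * ?F (d / e * R)) has_integral (e / d)^3 * integral {0..d} ?F) {0..e}"
    using e d by (simp add: field_simps power2_eq_square power3_eq_cube)
  then show ?thesis
  proof (rule has_integral_eq[rotated])
    fix R assume R: "R \<in> {0..e}"
    then show "(e / d)^2 * ?F (d / e * R)
       = energy_density (\<lambda>_. \<Phi> 0) (splice e d s r) (splice_deriv e d k g) R"
      using e d by (simp add: energy_density_def splice_def splice_deriv_def field_simps power2_eq_square)
  qed
qed

text \<open>Collects what bounded and unbounded slopes have in common. The densities agree beyond
  \<open>e\<close>, so only \<open>{0..e}\<close> is compared; the term
  \<open>\<eta> * e^3 / 3\<close> in \<open>gain\<close> is the integral of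
  \<open>\<eta> * R^2\<close>, the additive part of the perturbation.\<close>

lemma spliced_competitor:
  assumes r: "radial_pair r g" and int_r: "energy_density \<Phi> r g integrable_on {0..1}"
    and s: "radial_pair s k" and int_s: "energy_density (\<lambda>_. \<Phi> 0) s k integrable_on {0..1}"
    and e: "0 < e" "e \<le> 1" and d: "0 < d" "d \<le> 1" and eq: "s d / d = r e / e" and "\<eta> \<ge> 0"
    and pert: "\<And>R v1 v2 v3. 0 \<le> R \<Longrightarrow> R \<le> e \<Longrightarrow> v1 > 0 \<Longrightarrow> v2 > 0 \<Longrightarrow> v3 > 0 \<Longrightarrow>
       \<bar>\<Phi> R v1 v2 v3 - \<Phi> 0 v1 v2 v3\<bar> \<le> \<eta> * (\<Phi> 0 v1 v2 v3 + 1)"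
    and gain: "(1 + \<eta>) * ((e / d)^3 * integral {0..d} (energy_density (\<lambda>_. \<Phi> 0) s k)) + \<eta> * e^3 / 3 + \<kappa>
       \<le> integral {0..e} (energy_density \<Phi> r g)"
  obtains t t' where "radial_pair t t'" "energy_density \<Phi> t t' integrable_on {0..1}"
    "\<And>R. e \<le> R \<Longrightarrow> t R = r R"
    "integral {0..1} (energy_density \<Phi> t t') + \<kappa> \<le> integral {0..1} (energy_density \<Phi> r g)"
proof -
  define t where "t = splice e d s r"
  define t' where "t' = splice_deriv e d k g"
  have tt': "radial_pair t t'"
    unfolding t_def t'_def using s r e d eq by (rule radial_pair_splice)
  let ?T = "energy_density \<Phi> t t'" and ?Tz = "energy_density (\<lambda>_. \<Phi> 0) t t'"
    and ?Rd = "energy_density \<Phi> r g" and ?S = "energy_density (\<lambda>_. \<Phi> 0) s k"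
  have "?S integrable_on {0..d}"
    using d by (intro integrable_on_subinterval[OF int_s]) auto
  then have Tz: "(?Tz has_integral (e / d)^3 * integral {0..d} ?S) {0..e}"
    unfolding t_def t'_def using e(1) d(1) by (rule frozen_energy_splice)
  have bnd: "((\<lambda>R. (1 + \<eta>) * ?Tz R + \<eta> * R^2) has_integral
      (1 + \<eta>) * ((e / d)^3 * integral {0..d} ?S) + \<eta> * (e^3 / 3)) {0..e}"
    using e by (intro has_integral_add has_integral_mult_right Tz has_integral_square) auto
  have le: "?T R \<le> (1 + \<eta>) * ?Tz R + \<eta> * R^2" if R: "0 \<le> R" "R \<le> e" for R
  proof (cases "R = 0")
    case False
    then have p: "t' R > 0" "t R / R > 0"
      using R e radial_pair_pos[OF tt', of R] radial_pair_deriv_pos[OF tt', of R] by auto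
    have "\<Phi> R (t' R) (t R / R) (t R / R) \<le> (1 + \<eta>) * \<Phi> 0 (t' R) (t R / R) (t R / R) + \<eta>"
      using pert[OF R p(1) p(2) p(2)] by (simp add: algebra_simps)
    from mult_right_mono[OF this, of "R^2"] show ?thesis
      by (simp add: energy_density_def algebra_simps)
  qed simp
  \<comment> \<open>Finite energy of the competitor for the true coefficients follows by domination
    from its frozen energy.\<close>
  have inner: "?T integrable_on {0..e}"
  proof (rule measurable_bounded_by_integrable_imp_integrable)
    show "?T \<in> borel_measurable (lebesgue_on {0..e})"
      by (rule measurable_restrict_mono[OF energy_density_measurable[OF tt']]) (use e in auto)
    show "(\<lambda>R. (1 + \<eta>) * ?Tz R + \<eta> * R^2) integrable_on {0..e}"
      using bnd by (rule has_integral_integrable)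
    show "norm (?T R) \<le> (1 + \<eta>) * ?Tz R + \<eta> * R^2" if "R \<in> {0..e}" for R
      using le[of R] energy_density_nonneg[OF tt', of R] that e by simp
  qed simp
  have inner_le: "integral {0..e} ?T \<le> (1 + \<eta>) * ((e / d)^3 * integral {0..d} ?S) + \<eta> * (e^3 / 3)"
    by (rule has_integral_le[OF integrable_integral[OF inner] bnd]) (use le in auto)
  have Re: "?Rd integrable_on {e..1}" "?Rd integrable_on {0..e}"
    using e by (auto intro!: integrable_on_subinterval[OF int_r])
  have tR: "t R = r R" if "e \<le> R" for R
    unfolding t_def by (rule splice_outer) (use e d eq that in auto)
  have "(?T has_integral integral {e..1} ?Rd) {e..1}"
  proof (rule has_integral_spike_finite[of "{e}" _ _ ?Rd])
    show "?T R = ?Rd R" if "R \<in> {e..1} - {e}" for R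
      using that tR[of R] by (simp add: energy_density_def t'_def splice_deriv_def)
  qed (use Re in \<open>auto simp: integrable_integral\<close>)
  from has_integral_combine[OF _ _ integrable_integral[OF inner] this]
  have T: "(?T has_integral integral {0..e} ?T + integral {e..1} ?Rd) {0..1}"
    using e by simp
  have "integral {0..e} ?Rd + integral {e..1} ?Rd = integral {0..1} ?Rd"
    using e int_r by (intro Henstock_Kurzweil_Integration.integral_combine) auto
  then have "integral {0..1} ?T + \<kappa> \<le> integral {0..1} ?Rd"
    using integral_unique[OF T] inner_le gain by simp
  then show thesis
    using has_integral_integrable[OF T] tt' tR by (intro that[of t t'])
qed

text \<open>Intermediate value theorem for \<open>s d - \<mu> * d\<close>: the cavity makes it
  positive at 0, which also keeps the zero away from the origin, and \<open>s 1 <= \<mu>\<close>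
  makes it nonpositive at 1.\<close>

lemma matching_radius:
  assumes s: "radial_pair s k" and "s 0 > 0" "s 1 \<le> \<mu>"
  obtains d where "0 < d" "d \<le> 1" "s d / d = \<mu>"
proof -
  have "\<exists>d. 0 \<le> d \<and> d \<le> 1 \<and> s d - \<mu> * d = 0"
    by (rule IVT2') (use assms in \<open>auto intro!: continuous_intros radial_pair_continuous[OF s]\<close>)
  then obtain d where d: "0 \<le> d" "d \<le> 1" "s d - \<mu> * d = 0" by blast
  then have "d \<noteq> 0" using assms by auto
  with d show thesis by (intro that[of d]) (auto simp: field_simps)
qed

lemma homogeneous_energy_bounded:
  assumes "0 < a"
  obtains B where "B \<ge> 0" "\<And>\<mu>. a \<le> \<mu> \<Longrightarrow> \<mu> \<le> b \<Longrightarrow> \<Phi> 0 \<mu> \<mu> \<mu> \<le> B"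
proof -
  have c: "continuous_on {0<..} f" if "convex_on {0<..} f" for f :: "real \<Rightarrow> real"
    using that by (intro convex_on_continuous) auto
  have "continuous_on {a..b} (\<lambda>\<mu>. \<Phi> 0 \<mu> \<mu> \<mu>)"
    unfolding stored_energy_def using assms
    by (intro continuous_intros continuous_on_compose2[OF c[OF convex(1)]]
        continuous_on_compose2[OF c[OF convex(2)]] continuous_on_compose2[OF c[OF convex(3)]]) auto
  then have "bounded ((\<lambda>\<mu>. \<Phi> 0 \<mu> \<mu> \<mu>) ` {a..b})"
    by (intro compact_imp_bounded compact_continuous_image) auto
  then obtain B where B: "\<forall>x\<in>(\<lambda>\<mu>. \<Phi> 0 \<mu> \<mu> \<mu>) ` {a..b}. norm x \<le> B"
    unfolding bounded_iff by blast
  show thesis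
  proof (rule that[of "max 0 B"])
    show "\<Phi> 0 \<mu> \<mu> \<mu> \<le> max 0 B" if "a \<le> \<mu>" "\<mu> \<le> b" for \<mu>
    proof -
      have "norm (\<Phi> 0 \<mu> \<mu> \<mu>) \<le> B" using B that by auto
      then show ?thesis by simp
    qed
  qed simp
qed

text \<open>The perturbation parameter \<eta> has to be fixed before \<open>e\<close>, since the
  radius on which the coefficients are nearly frozen depends on it. A bound on the homogeneous
  energy that is uniform over the slope range makes this possible.\<close>

lemma competitor_bounded_slope:
  assumes r: "radial_pair r g" and int_r: "energy_density \<Phi> r g integrable_on {0..1}" and r0: "r 0 = 0"
    and s: "radial_pair s k" and int_s: "energy_density (\<lambda>_. \<Phi> 0) s k integrable_on {0..1}"
    and gap: "integral {0..1} (energy_density (\<lambda>_. \<Phi> 0) s k) < \<Phi> 0 (s 1) (s 1) (s 1) / 3"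
    and e0: "e0 > 0" "\<And>e. 0 < e \<Longrightarrow> e \<le> e0 \<Longrightarrow> s 1 \<le> r e / e \<and> r e / e \<le> b"
  obtains \<kappa> e1 where "\<kappa> > 0" "e1 > 0" "\<And>e. 0 < e \<Longrightarrow> e \<le> e1 \<Longrightarrow>
     \<exists>t t'. radial_pair t t' \<and> energy_density \<Phi> t t' integrable_on {0..1} \<and> (\<forall>R\<ge>e. t R = r R) \<and>
       integral {0..1} (energy_density \<Phi> t t') + \<kappa> * e^3 \<le> integral {0..1} (energy_density \<Phi> r g)"
proof -
  have s1: "s 1 > 0" using radial_pair_pos[OF s] by simp
  have s0: "s 0 > 0" using s int_s gap by (rule cavity_if_energy_gap)
  define \<kappa> where "\<kappa> = \<Phi> 0 (s 1) (s 1) (s 1) / 3 - integral {0..1} (energy_density (\<lambda>_. \<Phi> 0) s k)"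
  have \<kappa>: "\<kappa> > 0" using gap by (simp add: \<kappa>_def)
  obtain B where B: "B \<ge> 0" "\<And>\<mu>. s 1 \<le> \<mu> \<Longrightarrow> \<mu> \<le> b \<Longrightarrow> \<Phi> 0 \<mu> \<mu> \<mu> \<le> B"
    by (rule homogeneous_energy_bounded[OF s1]) (rule that)
  \<comment> \<open>Half of the gap is reserved for the perturbation,
    \<open>\<eta> * (B + 1) <= \<kappa> / 2\<close>; the cap at 1 keeps \<open>1 - \<eta>\<close>
    nonnegative.\<close>
  define \<eta> where "\<eta> = min 1 (\<kappa> / (2 * (B + 1)))"
  have \<eta>: "0 < \<eta>" "\<eta> \<le> 1" using \<kappa> B(1) by (auto simp: \<eta>_def)
  have "\<eta> * (B + 1) \<le> \<kappa> / (2 * (B + 1)) * (B + 1)"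
    using B(1) by (intro mult_right_mono) (auto simp: \<eta>_def)
  also have "\<dots> = \<kappa> / 2"
  proof -
    have *: "x / (2 * y) * y = x / 2" if "y > 0" for x y :: real using that by simp
    show ?thesis by (rule *) (use B(1) in simp)
  qed
  finally have \<eta>B: "\<eta> * (B + 1) \<le> \<kappa> / 2" .
  obtain e2 where e2: "0 < e2" "e2 \<le> 1"
    "\<And>R v1 v2 v3. 0 \<le> R \<Longrightarrow> R \<le> e2 \<Longrightarrow> v1 > 0 \<Longrightarrow> v2 > 0 \<Longrightarrow> v3 > 0 \<Longrightarrow>
       \<bar>\<Phi> R v1 v2 v3 - \<Phi> 0 v1 v2 v3\<bar> \<le> \<eta> * (\<Phi> 0 v1 v2 v3 + 1)"
    by (rule frozen_perturbation[OF \<eta>(1)]) (rule that)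
  show thesis
  proof (rule that[of "\<kappa> / 2" "min e0 e2"])
    fix e assume e: "0 < e" "e \<le> min e0 e2"
    then have e1: "e \<le> 1" using e2 by simp
    define \<mu> where "\<mu> = r e / e"
    define P where "P = \<Phi> 0 \<mu> \<mu> \<mu>"
    have \<mu>: "s 1 \<le> \<mu>" "\<mu> \<le> b" using e0(2)[of e] e by (auto simp: \<mu>_def)
    have P: "0 \<le> P" "P \<le> B" using \<Phi>_pos[of 0 \<mu> \<mu> \<mu>] B(2)[OF \<mu>] \<mu> s1 by (auto simp: P_def)
    obtain d where d: "0 < d" "d \<le> 1" "s d / d = \<mu>"
      by (rule matching_radius[OF s s0 \<mu>(1)]) (rule that)
    let ?Ed = "integral {0..d} (energy_density (\<lambda>_. \<Phi> 0) s k)"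
    have "?Ed \<le> d^3 * P / 3 - \<kappa>"
      using inner_energy_gap[OF s int_s d(1,2)] unfolding d(3) P_def \<kappa>_def .
    from mult_left_mono[OF this, of "(e / d)^3"]
    have "(e / d)^3 * ?Ed \<le> e^3 * P / 3 - (e / d)^3 * \<kappa>"
      using e d by (simp add: field_simps)
    \<comment> \<open>Here \<open>d <= 1\<close> is used: shrinking from radius \<open>d\<close> to
      \<open>e\<close> keeps at least the fraction \<open>e^3\<close> of the gap.\<close>
    moreover have "e^3 * \<kappa> \<le> (e / d)^3 * \<kappa>"
      using e d \<kappa> by (intro mult_right_mono power_mono) (auto simp: field_simps)
    ultimately have Ed: "(e / d)^3 * ?Ed \<le> e^3 * (P / 3 - \<kappa>)" by (simp add: algebra_simps)
    obtain L where L: "(L has_integral e^3 * \<Phi> 0 (r e / e) (r e / e) (r e / e) / 3) {0..e}"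
      "\<And>R. 0 \<le> R \<Longrightarrow> R \<le> e \<Longrightarrow> L R \<le> energy_density (\<lambda>_. \<Phi> 0) r g R"
      by (rule no_cavity_lower_bound[OF r r0 e(1) e1]) (rule that)
    have "(1 - \<eta>) * (e^3 * P / 3) - \<eta> * (e^3 / 3) \<le> integral {0..e} (energy_density \<Phi> r g)"
    proof (rule has_integral_le)
      show "((\<lambda>R. (1 - \<eta>) * L R - \<eta> * R^2) has_integral
          (1 - \<eta>) * (e^3 * P / 3) - \<eta> * (e^3 / 3)) {0..e}"
        using e L(1) unfolding P_def \<mu>_def
        by (intro has_integral_diff has_integral_mult_right has_integral_square) auto
      show "(energy_density \<Phi> r g has_integral integral {0..e} (energy_density \<Phi> r g)) {0..e}"
        using e1 by (intro integrable_integral integrable_on_subinterval[OF int_r]) auto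
      fix R assume R: "R \<in> {0..e}"
      show "(1 - \<eta>) * L R - \<eta> * R^2 \<le> energy_density \<Phi> r g R"
      proof (cases "R = 0")
        case True
        then show ?thesis using L(2)[of 0] e \<eta> by (simp add: mult_nonneg_nonpos)
      next
        case False
        then have p: "g R > 0" "r R / R > 0"
          using R e1 radial_pair_pos[OF r, of R] radial_pair_deriv_pos[OF r, of R] by auto
        have "(1 - \<eta>) * \<Phi> 0 (g R) (r R / R) (r R / R) - \<eta> \<le> \<Phi> R (g R) (r R / R) (r R / R)"
          using e2(3)[of R, OF _ _ p(1) p(2) p(2)] R e by (simp add: algebra_simps)
        from mult_right_mono[OF this, of "R^2"]
        have "(1 - \<eta>) * energy_density (\<lambda>_. \<Phi> 0) r g R - \<eta> * R^2 \<le> energy_density \<Phi> r g R"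
          by (simp add: energy_density_def algebra_simps)
        moreover have "(1 - \<eta>) * L R \<le> (1 - \<eta>) * energy_density (\<lambda>_. \<Phi> 0) r g R"
          using L(2)[of R] R \<eta> by (intro mult_left_mono) auto
        ultimately show ?thesis by simp
      qed
    qed
    moreover have "(1 + \<eta>) * ((e / d)^3 * ?Ed) \<le> (1 + \<eta>) * (e^3 * (P / 3 - \<kappa>))"
      using Ed \<eta> by (intro mult_left_mono) auto
    \<comment> \<open>The perturbation is paid once for the competitor and once for
      \<open>r\<close>. Per \<open>e^3\<close> this amounts to
      \<open>2 / 3 * \<eta> * (P + 1)\<close>, at most \<open>\<kappa> / 3\<close>.\<close>
    moreover have "(1 + \<eta>) * (e^3 * (P / 3 - \<kappa>)) + \<eta> * e^3 / 3 + \<kappa> / 2 * e^3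
       \<le> (1 - \<eta>) * (e^3 * P / 3) - \<eta> * (e^3 / 3)"
    proof -
      have "\<eta> * (P + 1) \<le> \<eta> * (B + 1)" using P \<eta> by (intro mult_left_mono) auto
      then have "\<eta> * P + \<eta> \<le> \<kappa> / 2" using \<eta>B by (simp add: algebra_simps)
      moreover have "0 \<le> \<eta> * P" "0 \<le> \<eta> * \<kappa>" using P \<eta> \<kappa> by auto
      ultimately have "0 \<le> \<kappa> / 2 + \<eta> * \<kappa> - 2 * (\<eta> * P) / 3 - 2 * \<eta> / 3" using \<eta> by linarith
      then have "0 \<le> e^3 * (\<kappa> / 2 + \<eta> * \<kappa> - 2 * (\<eta> * P) / 3 - 2 * \<eta> / 3)"
        using e by simp
      also have "\<dots> = ((1 - \<eta>) * (e^3 * P / 3) - \<eta> * (e^3 / 3))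
          - ((1 + \<eta>) * (e^3 * (P / 3 - \<kappa>)) + \<eta> * e^3 / 3 + \<kappa> / 2 * e^3)"
        by (simp add: field_simps)
      finally show ?thesis by simp
    qed
    ultimately have gain: "(1 + \<eta>) * ((e / d)^3 * ?Ed) + \<eta> * e^3 / 3 + \<kappa> / 2 * e^3
       \<le> integral {0..e} (energy_density \<Phi> r g)" by linarith
    obtain t t' where "radial_pair t t'" "energy_density \<Phi> t t' integrable_on {0..1}"
      "\<And>R. e \<le> R \<Longrightarrow> t R = r R"
      "integral {0..1} (energy_density \<Phi> t t') + \<kappa> / 2 * e^3 \<le> integral {0..1} (energy_density \<Phi> r g)"
    proof (rule spliced_competitor[OF r int_r s int_s e(1) e1 d(1,2) _ less_imp_le[OF \<eta>(1)] _ gain])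
      show "s d / d = r e / e" using d(3) by (simp add: \<mu>_def)
      show "\<bar>\<Phi> R v1 v2 v3 - \<Phi> 0 v1 v2 v3\<bar> \<le> \<eta> * (\<Phi> 0 v1 v2 v3 + 1)"
        if "0 \<le> R" "R \<le> e" "v1 > 0" "v2 > 0" "v3 > 0" for R v1 v2 v3
        using e2(3)[OF that(1) _ that(3-5)] that(2) e by simp
    qed (rule that)
    then show "\<exists>t t'. radial_pair t t' \<and> energy_density \<Phi> t t' integrable_on {0..1} \<and> (\<forall>R\<ge>e. t R = r R) \<and>
       integral {0..1} (energy_density \<Phi> t t') + \<kappa> / 2 * e^3 \<le> integral {0..1} (energy_density \<Phi> r g)"
      by (intro exI[of _ t] exI[of _ t'] conjI allI impI)
  qed (use \<kappa> e0 e2 in auto)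
qed

text \<open>When the slope blows up, the superlinear growth in the determinant makes the energy of
  \<open>r\<close> in \<open>[0,e]\<close> exceed every multiple of \<open>r(e)\<^sup>3\<close>, while the rescaled cavitating map costs only
  \<open>O(r(e)\<^sup>3)\<close>.\<close>

lemma competitor_unbounded_slope:
  assumes r: "radial_pair r g" and int_r: "energy_density \<Phi> r g integrable_on {0..1}" and r0: "r 0 = 0"
    and s: "radial_pair s k" and int_s: "energy_density (\<lambda>_. \<Phi> 0) s k integrable_on {0..1}"
    and s0: "s 0 > 0"
    and unb: "\<And>N. \<exists>e0>0. \<forall>e. 0 < e \<and> e \<le> e0 \<longrightarrow> N \<le> r e / e"
  obtains e1 where "e1 > 0" "\<And>e. 0 < e \<Longrightarrow> e \<le> e1 \<Longrightarrow>
     \<exists>t t'. radial_pair t t' \<and> energy_density \<Phi> t t' integrable_on {0..1} \<and> (\<forall>R\<ge>e. t R = r R) \<and>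
       integral {0..1} (energy_density \<Phi> t t') + 1 * e^3 \<le> integral {0..1} (energy_density \<Phi> r g)"
proof -
  define E where "E = integral {0..1} (energy_density (\<lambda>_. \<Phi> 0) s k)"
  have Fnn: "0 \<le> energy_density (\<lambda>_. \<Phi> 0) s k R" if "R \<in> {0..1}" for R
  proof (cases "R = 0")
    case False
    then show ?thesis
      using \<Phi>_pos[of 0 "k R" "s R / R" "s R / R"] radial_pair_pos[OF s, of R]
        radial_pair_deriv_pos[OF s, of R] that
      by (simp add: energy_density_def less_imp_le)
  qed simp
  have E0: "E \<ge> 0" unfolding E_def by (rule integral_nonneg[OF int_s]) (use Fnn in auto)
  define N where "N = 3 * (2 * E / s 0 ^ 3 + 1)"
  obtain D where D: "D \<ge> 0"
    "\<And>R v1 v2 v3. R \<in> {0..1} \<Longrightarrow> v1 > 0 \<Longrightarrow> v2 > 0 \<Longrightarrow> v3 > 0 \<Longrightarrow> \<Phi> R v1 v2 v3 \<ge> N * (v1 * v2 * v3) - D"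
    by (rule superlinear_det[of N]) (rule that)
  \<comment> \<open>The bound \<open>s 1\<close> is what \<open>matching_radius\<close> asks for;
    \<open>D + 2\<close> gives \<open>(D + 4) / 3 <= \<mu> <= \<mu>^3\<close>, which absorbs the
    terms of order \<open>e^3\<close>.\<close>
  obtain e0 where e0: "e0 > 0" "\<And>e. 0 < e \<Longrightarrow> e \<le> e0 \<Longrightarrow> max (s 1) (D + 2) \<le> r e / e"
    using unb by blast
  \<comment> \<open>Relative error 1 is affordable: it merely doubles the competitor's frozen cost,
    and \<open>r\<close> is estimated directly with the true coefficients.\<close>
  obtain e2 where e2: "0 < e2" "e2 \<le> 1"
    "\<And>R v1 v2 v3. 0 \<le> R \<Longrightarrow> R \<le> e2 \<Longrightarrow> v1 > 0 \<Longrightarrow> v2 > 0 \<Longrightarrow> v3 > 0 \<Longrightarrow>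
       \<bar>\<Phi> R v1 v2 v3 - \<Phi> 0 v1 v2 v3\<bar> \<le> 1 * (\<Phi> 0 v1 v2 v3 + 1)"
    by (rule frozen_perturbation[of 1]) (use that in auto)
  show thesis
  proof (rule that[of "min e0 e2"])
    fix e assume e: "0 < e" "e \<le> min e0 e2"
    then have e1: "e \<le> 1" using e2 by simp
    define \<mu> where "\<mu> = r e / e"
    have \<mu>: "s 1 \<le> \<mu>" "D + 2 \<le> \<mu>" using e0(2)[of e] e by (auto simp: \<mu>_def)
    have re: "r e = \<mu> * e" using e by (simp add: \<mu>_def)
    obtain d where d: "0 < d" "d \<le> 1" "s d / d = \<mu>"
      by (rule matching_radius[OF s s0 \<mu>(1)]) (rule that)
    let ?Ed = "integral {0..d} (energy_density (\<lambda>_. \<Phi> 0) s k)"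
    have "?Ed \<le> E"
      unfolding E_def by (rule integral_subset_le) (use Fnn d int_s in \<open>auto intro: integrable_on_subinterval\<close>)
    \<comment> \<open>The matching \<open>r e / e = s d / d >= s 0 / d\<close> bounds the scaling
      factor by \<open>r e / s 0\<close>; this is the source of the cost of order
      \<open>r e ^ 3\<close>.\<close>
    moreover have "e / d \<le> r e / s 0"
    proof -
      have "s 0 \<le> s d" using radial_pair_mono[OF s, of 0 d] d by simp
      then have "s 0 / d \<le> \<mu>" using d by (simp add: divide_right_mono flip: d(3))
      then have "s 0 * e \<le> \<mu> * d * e" using d e by (simp add: field_simps)
      then show ?thesis using d s0 by (simp add: re field_simps)
    qed
    moreover have "r e > 0" using radial_pair_pos[OF r e(1) e1] .
    ultimately have "(e / d)^3 * ?Ed \<le> (r e / s 0)^3 * E"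
      using e d E0 s0 by (intro mult_mono power_mono) (auto intro!: integral_nonneg integrable_on_subinterval[OF int_s] Fnn)
    then have "(1 + 1) * ((e / d)^3 * ?Ed) \<le> 2 * ((r e / s 0)^3 * E)" by simp
    also have "\<dots> = 2 * E / s 0 ^ 3 * r e ^ 3" by (simp add: power_divide)
    finally have B: "(1 + 1) * ((e / d)^3 * ?Ed) \<le> 2 * E / s 0 ^ 3 * r e ^ 3" .
    have "N * (r e ^ 3 / 3) - D * (e^3 / 3) \<le> integral {0..e} (energy_density \<Phi> r g)"
    proof (rule has_integral_le)
      note rp = radial_pair_primitive[OF r]
      \<comment> \<open>The determinant with weight \<open>R^2\<close> is
        \<open>g R * (r R)^2\<close>, the derivative of \<open>r R ^ 3 / 3\<close>; without a cavity
        its integral is all of \<open>r e ^ 3 / 3\<close>.\<close>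
      have "((\<lambda>R. g R * (r R * r R) + (g R * r R + g R * r R) * r R) has_integral r e * (r e * r e)) {0..e}"
        using primitive_on_has_integral[OF primitive_on_mult[OF rp primitive_on_mult[OF rp rp]], of 0 e] e e1 r0
        by simp
      from has_integral_mult_right[OF this, of "1/3"]
      have "((\<lambda>R. g R * (r R)^2) has_integral r e ^ 3 / 3) {0..e}"
        by (simp add: algebra_simps power2_eq_square power3_eq_cube)
      then show "((\<lambda>R. N * (g R * (r R)^2) - D * R^2) has_integral
          N * (r e ^ 3 / 3) - D * (e^3 / 3)) {0..e}"
        using e by (intro has_integral_diff has_integral_mult_right has_integral_square) auto
      show "(energy_density \<Phi> r g has_integral integral {0..e} (energy_density \<Phi> r g)) {0..e}"
        using e1 by (intro integrable_integral integrable_on_subinterval[OF int_r]) auto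
      fix R assume R: "R \<in> {0..e}"
      show "N * (g R * (r R)^2) - D * R^2 \<le> energy_density \<Phi> r g R"
      proof (cases "R = 0")
        case False
        then have p: "g R > 0" "r R / R > 0" "R \<in> {0..1}"
          using R e1 radial_pair_pos[OF r, of R] radial_pair_deriv_pos[OF r, of R] by auto
        have "N * (g R * (r R)^2) - D * R^2 = (N * (g R * (r R / R) * (r R / R)) - D) * R^2"
          using False by (simp add: power2_eq_square left_diff_distrib)
        also have "\<dots> \<le> energy_density \<Phi> r g R"
          unfolding energy_density_def by (rule mult_right_mono[OF D(2)[OF p(3) p(1) p(2) p(2)]]) simp
        finally show ?thesis .
      qed (simp add: r0)
    qed
    moreover have "N * (r e ^ 3 / 3) = 2 * E / s 0 ^ 3 * r e ^ 3 + r e ^ 3"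
      by (simp add: N_def algebra_simps)
    moreover have "D * (e^3 / 3) + 1 * e^3 / 3 + 1 * e^3 \<le> r e ^ 3"
    proof -
      have "D / 3 + 4 / 3 \<le> \<mu>" using \<mu> D(1) by simp
      also have "\<mu> \<le> \<mu> ^ 3" using \<mu> D(1) by (intro self_le_power) auto
      finally have "(D / 3 + 4 / 3) * e^3 \<le> \<mu>^3 * e^3" using e by (intro mult_right_mono) auto
      then show ?thesis by (simp add: re power_mult_distrib algebra_simps)
    qed
    ultimately have gain: "(1 + 1) * ((e / d)^3 * ?Ed) + 1 * e^3 / 3 + 1 * e^3
       \<le> integral {0..e} (energy_density \<Phi> r g)" using B by linarith
    obtain t t' where "radial_pair t t'" "energy_density \<Phi> t t' integrable_on {0..1}"
      "\<And>R. e \<le> R \<Longrightarrow> t R = r R"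
      "integral {0..1} (energy_density \<Phi> t t') + 1 * e^3 \<le> integral {0..1} (energy_density \<Phi> r g)"
    proof (rule spliced_competitor[OF r int_r s int_s e(1) e1 d(1,2) _ zero_le_one _ gain])
      show "s d / d = r e / e" using d(3) by (simp add: \<mu>_def)
      show "\<bar>\<Phi> R v1 v2 v3 - \<Phi> 0 v1 v2 v3\<bar> \<le> 1 * (\<Phi> 0 v1 v2 v3 + 1)"
        if "0 \<le> R" "R \<le> e" "v1 > 0" "v2 > 0" "v3 > 0" for R v1 v2 v3
        using e2(3)[OF that(1) _ that(3-5)] that(2) e by simp
    qed (rule that)
    then show "\<exists>t t'. radial_pair t t' \<and> energy_density \<Phi> t t' integrable_on {0..1} \<and> (\<forall>R\<ge>e. t R = r R) \<and>
       integral {0..1} (energy_density \<Phi> t t') + 1 * e^3 \<le> integral {0..1} (energy_density \<Phi> r g)"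
      by (intro exI[of _ t] exI[of _ t'] conjI allI impI)
  qed (use e0 e2 in auto)
qed

end

section \<open>The gravitational potential\<close>

lemma mass_integrand_abs_integrable:
  fixes \<rho> :: "real \<Rightarrow> real"
  assumes m: "\<rho> \<in> borel_measurable (lebesgue_on {0..1})" and b: "\<forall>R\<in>{0..1}. 0 \<le> \<rho> R \<and> \<rho> R \<le> k"
  shows "(\<lambda>u. \<rho> u * u\<^sup>2) absolutely_integrable_on {0..1}"
proof (rule measurable_bounded_by_integrable_imp_absolutely_integrable)
  have "(\<lambda>u. u) \<in> borel_measurable (lebesgue_on {0..1::real})"
    by (intro continuous_imp_measurable_on_sets_lebesgue continuous_intros) auto
  then show "(\<lambda>u. \<rho> u * u\<^sup>2) \<in> borel_measurable (lebesgue_on {0..1})"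
    by (intro borel_measurable_times m borel_measurable_power)
  show "(\<lambda>u::real. k) integrable_on {0..1}" by (intro integrable_continuous_real continuous_intros)
  fix u :: real assume u: "u \<in> {0..1}"
  then have "\<rho> u * u\<^sup>2 \<le> k * 1"
    using b by (intro mult_mono) (auto simp: power_le_one)
  then show "norm (\<rho> u * u\<^sup>2) \<le> k" using b u by simp
qed simp

lemma mass_in_eq_integral:
  assumes "\<rho> \<in> borel_measurable (lebesgue_on {0..1})" "\<forall>R\<in>{0..1}. 0 \<le> \<rho> R \<and> \<rho> R \<le> k"
    and "0 \<le> R" "R \<le> 1"
  shows "mass_in \<rho> R = 4 * pi * integral {0..R} (\<lambda>u. \<rho> u * u\<^sup>2)"
    "(\<lambda>u. \<rho> u * u\<^sup>2) integrable_on {0..R}"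
proof -
  have "(\<lambda>u. \<rho> u * u\<^sup>2) absolutely_integrable_on {0..R}"
    using assms(3,4) by (intro absolutely_integrable_on_subinterval[OF mass_integrand_abs_integrable[OF assms(1,2)]]) auto
  then show "mass_in \<rho> R = 4 * pi * integral {0..R} (\<lambda>u. \<rho> u * u\<^sup>2)"
    "(\<lambda>u. \<rho> u * u\<^sup>2) integrable_on {0..R}"
    by (simp_all add: mass_in_def set_lebesgue_integral_eq_integral)
qed

lemma mass_in_bounds:
  assumes \<rho>: "\<rho> \<in> borel_measurable (lebesgue_on {0..1})" "\<forall>R\<in>{0..1}. 0 \<le> \<rho> R \<and> \<rho> R \<le> k"
    and R: "0 \<le> R" "R \<le> 1"
  shows "0 \<le> mass_in \<rho> R" "mass_in \<rho> R \<le> 4 * pi * k * R^3"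
proof -
  note M = mass_in_eq_integral[OF \<rho> R]
  have "0 \<le> integral {0..R} (\<lambda>u. \<rho> u * u\<^sup>2)"
    by (rule integral_nonneg[OF M(2)]) (use \<rho>(2) R in auto)
  then show "0 \<le> mass_in \<rho> R" by (simp add: M(1))
  have "integral {0..R} (\<lambda>u. \<rho> u * u\<^sup>2) \<le> integral {0..R} (\<lambda>u. k * R\<^sup>2)"
  proof (rule integral_le[OF M(2)])
    show "\<rho> u * u\<^sup>2 \<le> k * R\<^sup>2" if "u \<in> {0..R}" for u
    proof (rule mult_mono)
      show "\<rho> u \<le> k" "0 \<le> k" using \<rho>(2) that R by force+
      show "u\<^sup>2 \<le> R\<^sup>2" using that by (intro power_mono) auto
    qed simp
  qed (intro integrable_continuous_real continuous_intros)
  also have "\<dots> = k * R^3" using R by (simp add: power2_eq_square power3_eq_cube)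
  finally have "4 * pi * integral {0..R} (\<lambda>u. \<rho> u * u\<^sup>2) \<le> 4 * pi * (k * R^3)"
    by (intro mult_left_mono) auto
  then show "mass_in \<rho> R \<le> 4 * pi * k * R^3"
    by (simp add: M(1))
qed

lemma potential_density_measurable:
  assumes \<rho>: "\<rho> \<in> borel_measurable (lebesgue_on {0..1})" "\<forall>R\<in>{0..1}. 0 \<le> \<rho> R \<and> \<rho> R \<le> k"
    and t: "continuous_on {0..1} t"
  shows "(\<lambda>R. ennreal (\<rho> R * (mass_in \<rho> R / t R) * R\<^sup>2) * indicator {0<..<1} R) \<in> borel_measurable lebesgue"
proof -
  let ?M = "lebesgue_on {0..1::real}"
  have cont: "f \<in> borel_measurable ?M" if "continuous_on {0..1} f" for f :: "real \<Rightarrow> real"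
    using that by (intro continuous_imp_measurable_on_sets_lebesgue) auto
  have "continuous_on {0..1} (\<lambda>R. 4 * pi * integral {0..R} (\<lambda>u. \<rho> u * u\<^sup>2))"
    using mass_in_eq_integral(2)[OF \<rho>, of 1]
    by (intro continuous_intros indefinite_integral_continuous_1) auto
  then have "continuous_on {0..1} (mass_in \<rho>)"
    by (rule continuous_on_eq) (use mass_in_eq_integral(1)[OF \<rho>] in auto)
  then have [measurable]: "mass_in \<rho> \<in> borel_measurable ?M" "t \<in> borel_measurable ?M"
    "(\<lambda>R. R) \<in> borel_measurable ?M" "\<rho> \<in> borel_measurable ?M"
    using t \<rho>(1) by (auto intro!: cont continuous_intros)
  have "(\<lambda>R. \<rho> R * (mass_in \<rho> R / t R) * R\<^sup>2) \<in> borel_measurable ?M" by measurable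
  then have "(\<lambda>R. if R \<in> {0..1} then \<rho> R * (mass_in \<rho> R / t R) * R\<^sup>2 else 0) \<in> borel_measurable lebesgue"
    by (rule borel_measurable_if_I) simp
  then have "(\<lambda>R. ennreal (if R \<in> {0..1} then \<rho> R * (mass_in \<rho> R / t R) * R\<^sup>2 else 0) * indicator {0<..<1} R)
     \<in> borel_measurable lebesgue"
    by (intro borel_measurable_times_ennreal measurable_compose[OF _ measurable_ennreal] borel_measurable_indicator) auto
  also have "(\<lambda>R. ennreal (if R \<in> {0..1} then \<rho> R * (mass_in \<rho> R / t R) * R\<^sup>2 else 0) * indicator {0<..<1} R)
     = (\<lambda>R. ennreal (\<rho> R * (mass_in \<rho> R / t R) * R\<^sup>2) * indicator {0<..<1} R)"
    by (auto simp: fun_eq_iff indicator_def)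
  finally show ?thesis .
qed

lemma potential_density_le:
  assumes \<rho>: "\<rho> \<in> borel_measurable (lebesgue_on {0..1})" "\<forall>R\<in>{0..1}. 0 \<le> \<rho> R \<and> \<rho> R \<le> k"
    and c: "c > 0" "c * R \<le> r R" and R: "0 < R" "R \<le> 1"
  shows "\<rho> R * (mass_in \<rho> R / r R) * R\<^sup>2 \<le> 4 * pi * k\<^sup>2 / c * R^4"
proof -
  have k: "0 \<le> k" using \<rho>(2) R by force
  have "0 < r R" using mult_pos_pos[OF c(1) R(1)] c(2) by linarith
  have "mass_in \<rho> R / r R \<le> (4 * pi * k * R^3) / (c * R)"
    using mass_in_bounds[OF \<rho>, of R] c R by (intro frac_le) auto
  also have "\<dots> = 4 * pi * k / c * R\<^sup>2" using R c by (simp add: power2_eq_square power3_eq_cube)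
  finally have "\<rho> R * (mass_in \<rho> R / r R) * R\<^sup>2 \<le> k * (4 * pi * k / c * R\<^sup>2) * R\<^sup>2"
    using \<rho>(2) R k c \<open>0 < r R\<close> mass_in_bounds(1)[OF \<rho>, of R]
    by (intro mult_mono mult_right_mono) auto
  also have "\<dots> = 4 * pi * k\<^sup>2 / c * R^4" by (simp add: power2_eq_square power4_eq_xxxx)
  finally show ?thesis .
qed

text \<open>The potential enters the total with a minus sign, so only its decrease is harmful. The
  contribution of \<open>t\<close> on \<open>{0..e}\<close> is dropped and that of \<open>r\<close>
  is bounded.\<close>

lemma I_pot_local_change:
  assumes \<rho>: "\<rho> \<in> borel_measurable (lebesgue_on {0..1})" "\<forall>R\<in>{0..1}. 0 \<le> \<rho> R \<and> \<rho> R \<le> k"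
    and c: "c > 0" "\<And>R. 0 < R \<Longrightarrow> R \<le> 1 \<Longrightarrow> c * R \<le> r R"
    and t: "continuous_on {0..1} t" and e: "0 < e" "e \<le> 1" and eq: "\<And>R. e \<le> R \<Longrightarrow> t R = r R"
  shows "I_pot \<rho> r \<le> I_pot \<rho> t + ennreal (4 * pi * k\<^sup>2 / c * e^5)"
proof -
  let ?f = "\<lambda>t R. ennreal (\<rho> R * (mass_in \<rho> R / t R) * R\<^sup>2) * indicator {0<..<1} R"
  \<comment> \<open>Supremum over \<open>{0..e}\<close> of the bound proportional to
    \<open>R^4\<close>; the length \<open>e\<close> of the interval supplies the fifth
    power.\<close>
  let ?K = "4 * pi * k\<^sup>2 / c * e^4"
  have K: "?K \<ge> 0" using c e by simp
  have "I_pot \<rho> r \<le> (\<integral>\<^sup>+R. ?f t R + ennreal ?K * indicator {0..e} R \<partial>lebesgue)"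
    unfolding I_pot_def
  proof (rule nn_integral_mono)
    fix R :: real
    show "?f r R \<le> ?f t R + ennreal ?K * indicator {0..e} R"
    proof (cases "0 < R \<and> R < e")
      case True
      have "\<rho> R * (mass_in \<rho> R / r R) * R\<^sup>2 \<le> 4 * pi * k\<^sup>2 / c * R^4"
        using potential_density_le[where r = r and R = R, OF \<rho> c(1) c(2)] True e by simp
      also have "\<dots> \<le> ?K"
        using True c by (intro mult_left_mono power_mono) auto
      finally have "?f r R \<le> ennreal ?K * indicator {0..e} R"
        using True e by (simp add: ennreal_leI)
      then show ?thesis by (rule order_trans) simp
    next
      case False
      then show ?thesis
        using eq[of R] by (cases "e \<le> R") (auto simp: indicator_def)
    qed
  qed
  also have "\<dots> = I_pot \<rho> t + (\<integral>\<^sup>+R. ennreal ?K * indicator {0..e} R \<partial>lebesgue)"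
    unfolding I_pot_def
    by (rule nn_integral_add[OF potential_density_measurable[OF \<rho> t]])
      (intro borel_measurable_times_ennreal borel_measurable_const borel_measurable_indicator, simp)
  also have "(\<integral>\<^sup>+R. ennreal ?K * indicator {0..e} R \<partial>lebesgue) = ennreal ?K * ennreal e"
    using e by (subst nn_integral_cmult_indicator) simp_all
  also have "\<dots> = ennreal (?K * e)"
    by (rule ennreal_mult[symmetric, OF K less_imp_le[OF e(1)]])
  also have "?K * e = 4 * pi * k\<^sup>2 / c * e^5" by (simp add: power_numeral_reduce)
  finally show ?thesis .
qed

lemma I_pot_finite:
  assumes \<rho>: "\<rho> \<in> borel_measurable (lebesgue_on {0..1})" "\<forall>R\<in>{0..1}. 0 \<le> \<rho> R \<and> \<rho> R \<le> k"
    and c: "c > 0" "\<And>R. 0 < R \<Longrightarrow> R \<le> 1 \<Longrightarrow> c * R \<le> r R"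
  shows "I_pot \<rho> r < \<infinity>"
proof -
  let ?K = "4 * pi * k\<^sup>2 / c"
  have "I_pot \<rho> r \<le> (\<integral>\<^sup>+R. ennreal ?K * indicator {0..1::real} R \<partial>lebesgue)"
    unfolding I_pot_def
  proof (rule nn_integral_mono)
    fix R :: real
    show "ennreal (\<rho> R * (mass_in \<rho> R / r R) * R\<^sup>2) * indicator {0<..<1} R \<le> ennreal ?K * indicator {0..1} R"
    proof (cases "0 < R \<and> R < 1")
      case True
      have "\<rho> R * (mass_in \<rho> R / r R) * R\<^sup>2 \<le> ?K * R^4"
        using potential_density_le[where r = r and R = R, OF \<rho> c(1) c(2)] True by simp
      also have "\<dots> \<le> ?K * 1"
        using True c by (intro mult_left_mono power_le_one) auto
      finally show ?thesis using True by (simp add: ennreal_leI)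
    qed (auto simp: indicator_def)
  qed
  also have "\<dots> < \<infinity>"
    by (subst nn_integral_cmult_indicator) (auto simp: ennreal_mult_less_top)
  finally show ?thesis .
qed

text \<open>Finiteness of \<open>I_pot \<rho> r\<close> keeps the total of \<open>r\<close> finite;
  an infinite potential of \<open>t\<close> would only push its total down to minus
  infinity.\<close>

lemma I_total_less:
  assumes r: "I_mec \<Phi> r = ennreal A" "0 \<le> A" and t: "I_mec \<Phi> t = ennreal B" "0 \<le> B"
    and fin: "I_pot \<rho> r < \<infinity>" and pot: "I_pot \<rho> r \<le> I_pot \<rho> t + ennreal \<delta>" "0 \<le> \<delta>"
    and less: "B + \<delta> < A"
  shows "I_total \<rho> \<Phi> t < I_total \<rho> \<Phi> r"
proof -
  obtain p where p: "I_pot \<rho> r = ennreal p" "0 \<le> p"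
    using fin by (cases "I_pot \<rho> r") auto
  show ?thesis
  proof (cases "I_pot \<rho> t")
    case (real q)
    then have "ennreal p \<le> ennreal (q + \<delta>)" using pot p by simp
    then have "p \<le> q + \<delta>" using real pot(2) by (subst (asm) ennreal_le_iff) auto
    then show ?thesis
      using r t p real less by (simp add: I_total_def enn2ereal_ennreal)
  next
    case top
    then show ?thesis
      using r t p by (simp add: I_total_def enn2ereal_ennreal)
  qed
qed

section \<open>Slopes near the origin and supercritical frozen maps\<close>

lemma slope_eventually_ge:
  assumes r: "primitive_on 0 1 r dr" and r0: "r 0 = 0"
    and ev: "\<forall>\<^sub>F x in at_right 0. N \<le> dr x"
  obtains e0 where "e0 > 0" "e0 \<le> 1" "\<And>e. 0 < e \<Longrightarrow> e \<le> e0 \<Longrightarrow> N \<le> r e / e"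
proof -
  obtain b where b: "b > 0" "\<And>x. 0 < x \<Longrightarrow> x < b \<Longrightarrow> N \<le> dr x"
    using ev by (auto simp: eventually_at_right_field)
  show thesis
  proof (rule that[of "min 1 (b / 2)"])
    fix e assume e: "0 < e" "e \<le> min 1 (b / 2)"
    \<comment> \<open>The limit says nothing about \<open>dr 0\<close>, so this single value is
      overwritten before the integrals are compared.\<close>
    define f where "f x = (if x = 0 then N else dr x)" for x
    have "(dr has_integral (r e - r 0)) {0..e}"
      using primitive_on_has_integral[OF r, of 0 e] e by simp
    then have f: "(f has_integral r e) {0..e}"
      unfolding r0 diff_zero by (rule has_integral_spike_finite[of "{0}", rotated 2]) (auto simp: f_def)
    have "((\<lambda>_. N) has_integral N * e) {0..e}"
      using has_integral_const_real[of N 0 e] e by (simp add: mult.commute)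
    then have "N * e \<le> r e"
      by (rule has_integral_le[OF _ f]) (use b e in \<open>auto simp: f_def\<close>)
    then show "N \<le> r e / e" using e by (simp add: field_simps)
  qed (use b in auto)
qed

context radial_energy
begin

lemma radial_energy_frozen: "radial_energy (\<lambda>_. \<alpha> 0) (\<lambda>_. \<beta> 0) (\<lambda>_. \<gamma> 0) \<phi> \<psi> h"
proof
  show "energy_growth (stored_energy (\<lambda>_. \<alpha> 0) (\<lambda>_. \<beta> 0) (\<lambda>_. \<gamma> 0) \<phi> \<psi> h)"
    unfolding stored_energy_frozen using growth by (rule energy_growth_frozen)
qed (use pos_coeff[of 0] convex nonneg in auto)

text \<open>No minimizer is needed: beyond the critical displacement the homogeneous map is not minimizing,
  because it has no cavity.\<close>

lemma supercritical_energy_gap: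
  assumes crit: "critical_displacement \<Phi> lam\<^sub>c" and \<mu>: "0 < \<mu>" "lam\<^sub>c < \<mu>"
  obtains s k where "radial_pair s k" "energy_density (\<lambda>_. \<Phi> 0) s k integrable_on {0..1}" "s 1 = \<mu>"
    "integral {0..1} (energy_density (\<lambda>_. \<Phi> 0) s k) < \<Phi> 0 \<mu> \<mu> \<mu> / 3"
proof -
  interpret H: radial_energy "\<lambda>_. \<alpha> 0" "\<lambda>_. \<beta> 0" "\<lambda>_. \<gamma> 0" \<phi> \<psi> h
    by (rule radial_energy_frozen)
  note fr = stored_energy_frozen
  define s0 where "s0 = (\<lambda>R. \<mu> * R)"
  have s0: "radial_pair s0 (\<lambda>_. \<mu>)"
    unfolding radial_pair_def s0_def
    using \<mu> by (auto intro!: primitive_on_C1 derivative_eq_intros)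
  have dens: "energy_density (\<lambda>_. \<Phi> 0) s0 (\<lambda>_. \<mu>) = (\<lambda>R. \<Phi> 0 \<mu> \<mu> \<mu> * R^2)"
    by (auto simp: energy_density_def s0_def fun_eq_iff)
  have int0: "(energy_density (\<lambda>_. \<Phi> 0) s0 (\<lambda>_. \<mu>) has_integral \<Phi> 0 \<mu> \<mu> \<mu> / 3) {0..1}"
    unfolding dens using has_integral_mult_right[OF has_integral_square[of 1], of "\<Phi> 0 \<mu> \<mu> \<mu>"] by simp
  have E0: "E_hom \<Phi> s0 = ennreal (\<Phi> 0 \<mu> \<mu> \<mu> / 3)"
    using H.I_mec_eq_integral[OF s0] has_integral_integrable[OF int0]
    by (simp add: fr E_hom_def integral_unique[OF int0])
  have adm0: "s0 \<in> admissible_hom \<Phi> \<mu>"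
    unfolding admissible_hom_def
    using H.admissibleI[OF s0, of \<mu>] has_integral_integrable[OF int0] by (simp add: fr s0_def)
  have "\<not> is_arg_min (E_hom \<Phi>) (\<lambda>s. s \<in> admissible_hom \<Phi> \<mu>) s0"
  proof
    assume "is_arg_min (E_hom \<Phi>) (\<lambda>s. s \<in> admissible_hom \<Phi> \<mu>) s0"
    then have "s0 0 > 0" using crit \<mu> by (simp add: critical_displacement_def)
    then show False by (simp add: s0_def)
  qed
  then obtain s where s: "s \<in> admissible_hom \<Phi> \<mu>" "E_hom \<Phi> s < E_hom \<Phi> s0"
    using adm0 by (auto simp: is_arg_min_def)
  have "s \<in> admissible (stored_energy (\<lambda>_. \<alpha> 0) (\<lambda>_. \<beta> 0) (\<lambda>_. \<gamma> 0) \<phi> \<psi> h) \<mu>"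
    using s(1) by (simp add: fr admissible_hom_def)
  then obtain k where k: "radial_pair s k"
    "energy_density (stored_energy (\<lambda>_. \<alpha> 0) (\<lambda>_. \<beta> 0) (\<lambda>_. \<gamma> 0) \<phi> \<psi> h) s k integrable_on {0..1}"
    by (rule H.admissibleE) (rule that)
  have Es: "E_hom \<Phi> s = ennreal (integral {0..1} (energy_density (\<lambda>_. \<Phi> 0) s k))"
    using H.I_mec_eq_integral[OF k] by (simp add: fr E_hom_def)
  show thesis
  proof (rule that[of s k])
    show "integral {0..1} (energy_density (\<lambda>_. \<Phi> 0) s k) < \<Phi> 0 \<mu> \<mu> \<mu> / 3"
    proof (rule ccontr)
      assume "\<not> ?thesis"
      then have "E_hom \<Phi> s0 \<le> E_hom \<Phi> s" unfolding Es E0 by (intro ennreal_leI) simp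
      then show False using s(2) by simp
    qed
    show "s 1 = \<mu>" using s(1) by (simp add: admissible_hom_def admissible_def)
  qed (use k in \<open>simp_all add: fr\<close>)
qed

end

section \<open>Supercritical slope at the origin\<close>

lemma smooth_on_unit_continuous:
  assumes "smooth_on_unit f"
  shows "continuous_on {0..1} f"
proof -
  obtain D where D: "D 0 = f" "\<And>n x. x \<in> {0..1} \<Longrightarrow> (D n has_real_derivative D (Suc n) x) (at x within {0..1})"
    using assms by (auto simp: smooth_on_unit_def)
  have "continuous_on {0..1} (D 0)"
    by (rule DERIV_continuous_on[of _ _ "D (Suc 0)"]) (rule D(2))
  then show ?thesis by (simp only: D(1))
qed

context radial_energy
begin

text \<open>Since \<mu> lies strictly below \<open>l\<close>, the slopes \<open>r e / e\<close>,
  being averages of \<open>dr\<close>, eventually reach \<open>s 1 = \<mu>\<close>. A finite limit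
  also bounds them above; an infinite one leads to the blow-up case.\<close>

lemma competitor_supercritical:
  assumes crit: "critical_displacement \<Phi> lam\<^sub>c" and \<mu>: "0 < \<mu>" "lam\<^sub>c < \<mu>" "ereal \<mu> < l"
    and r: "radial_pair r g" and int_r: "energy_density \<Phi> r g integrable_on {0..1}" and r0: "r 0 = 0"
    and dr: "primitive_on 0 1 r dr" and lim: "((\<lambda>R. ereal (dr R)) \<longlongrightarrow> l) (at_right 0)"
  obtains \<kappa> e1 where "\<kappa> > 0" "e1 > 0" "\<And>e. 0 < e \<Longrightarrow> e \<le> e1 \<Longrightarrow>
     \<exists>t t'. radial_pair t t' \<and> energy_density \<Phi> t t' integrable_on {0..1} \<and> (\<forall>R\<ge>e. t R = r R) \<and>
       integral {0..1} (energy_density \<Phi> t t') + \<kappa> * e^3 \<le> integral {0..1} (energy_density \<Phi> r g)"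
proof -
  obtain s k where s: "radial_pair s k" "energy_density (\<lambda>_. \<Phi> 0) s k integrable_on {0..1}" "s 1 = \<mu>"
    "integral {0..1} (energy_density (\<lambda>_. \<Phi> 0) s k) < \<Phi> 0 \<mu> \<mu> \<mu> / 3"
    by (rule supercritical_energy_gap[OF crit \<mu>(1,2)]) (rule that)
  have gap: "integral {0..1} (energy_density (\<lambda>_. \<Phi> 0) s k) < \<Phi> 0 (s 1) (s 1) (s 1) / 3"
    using s(3,4) by simp
  have lower: "\<exists>e0>0. \<forall>e. 0 < e \<and> e \<le> e0 \<longrightarrow> N \<le> r e / e" if "ereal N < l" for N
  proof -
    have "\<forall>\<^sub>F x in at_right 0. ereal N < ereal (dr x)"
      using lim that by (rule order_tendstoD(1))
    then have "\<forall>\<^sub>F x in at_right 0. N \<le> dr x"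
      by (rule eventually_mono) simp
    then obtain e0 where "e0 > 0" "\<And>e. 0 < e \<Longrightarrow> e \<le> e0 \<Longrightarrow> N \<le> r e / e"
      by (rule slope_eventually_ge[OF dr r0]) (rule that)
    then show ?thesis by blast
  qed
  show thesis
  proof (cases "l = \<infinity>")
    case True
    then have unb: "\<exists>e0>0. \<forall>e. 0 < e \<and> e \<le> e0 \<longrightarrow> N \<le> r e / e" for N
      by (intro lower) simp
    have "s 0 > 0" using s(1,2) gap by (rule cavity_if_energy_gap)
    then obtain e1 where "e1 > 0" "\<And>e. 0 < e \<Longrightarrow> e \<le> e1 \<Longrightarrow>
     \<exists>t t'. radial_pair t t' \<and> energy_density \<Phi> t t' integrable_on {0..1} \<and> (\<forall>R\<ge>e. t R = r R) \<and>
       integral {0..1} (energy_density \<Phi> t t') + 1 * e^3 \<le> integral {0..1} (energy_density \<Phi> r g)"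
      by (rule competitor_unbounded_slope[OF r int_r r0 s(1,2) _ unb]) (rule that)
    then show thesis by (rule that[OF zero_less_one])
  next
    case False
    then obtain l' where l': "l = ereal l'" using \<mu>(3) by (cases l) auto
    obtain ea where ea: "ea > 0" "\<And>e. 0 < e \<Longrightarrow> e \<le> ea \<Longrightarrow> \<mu> \<le> r e / e"
      using lower[OF \<mu>(3)] by blast
    \<comment> \<open>The upper bound on the slopes is the lower bound for
      \<open>-r\<close>.\<close>
    have dr': "primitive_on 0 1 (\<lambda>x. (-1) * r x) (\<lambda>x. (-1) * dr x)"
      using dr by (rule primitive_on_cmult)
    have "\<forall>\<^sub>F x in at_right 0. ereal (dr x) < ereal (l' + 1)"
      using lim by (rule order_tendstoD(2)) (simp add: l')
    then have "\<forall>\<^sub>F x in at_right 0. - (l' + 1) \<le> (-1) * dr x"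
      by (rule eventually_mono) simp
    then obtain eb where eb: "eb > 0" "\<And>e. 0 < e \<Longrightarrow> e \<le> eb \<Longrightarrow> - (l' + 1) \<le> (-1) * r e / e"
      by (rule slope_eventually_ge[OF dr', rotated]) (use r0 that in auto)
    have slope: "s 1 \<le> r e / e \<and> r e / e \<le> l' + 1" if "0 < e" "e \<le> min ea eb" for e
      using ea(2)[of e] eb(2)[of e] that s(3) by simp
    have "0 < min ea eb" using ea(1) eb(1) by simp
    then show thesis
      by (rule competitor_bounded_slope[OF r int_r r0 s(1,2) gap _ slope]) (assumption | rule that)+
  qed
qed

end

text \<open>The slope bound handles the neighbourhood of the origin; beyond \<open>e0\<close>
  monotonicity gives \<open>r R >= r e0 >= r e0 * R\<close>.\<close>

lemma linear_lower_bound: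
  assumes r: "radial_pair r g" and "0 < \<mu>" "0 < e0" "e0 \<le> 1"
    and sl: "\<And>e. 0 < e \<Longrightarrow> e \<le> e0 \<Longrightarrow> \<mu> \<le> r e / e"
  obtains c where "c > 0" "\<And>R. 0 < R \<Longrightarrow> R \<le> 1 \<Longrightarrow> c * R \<le> r R"
proof (rule that[of "min \<mu> (r e0)"])
  show "min \<mu> (r e0) > 0" using assms radial_pair_pos[OF r, of e0] by simp
  fix R :: real assume R: "0 < R" "R \<le> 1"
  show "min \<mu> (r e0) * R \<le> r R"
  proof (cases "R \<le> e0")
    case True
    have "min \<mu> (r e0) * R \<le> \<mu> * R" using R by (intro mult_right_mono) auto
    also have "\<dots> \<le> r R" using sl[of R] R True by (simp add: field_simps)
    finally show ?thesis .
  next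
    case False
    have "min \<mu> (r e0) * R \<le> r e0 * 1"
      using R assms radial_pair_pos[OF r, of e0] by (intro mult_mono) auto
    also have "\<dots> \<le> r R" using radial_pair_mono[OF r, of e0 R] False assms R by simp
    finally show ?thesis .
  qed
qed

theorem theorem5p3:
  fixes \<rho>\<^sub>0 :: "real \<Rightarrow> real" and k\<^sub>0 k\<^sub>1 :: real
    and \<alpha> \<beta> \<gamma> \<phi> \<psi> h :: "real \<Rightarrow> real"
    and \<Phi> :: "real \<Rightarrow> real \<Rightarrow> real \<Rightarrow> real \<Rightarrow> real"
    and lam lam\<^sub>c :: real and r dr :: "real \<Rightarrow> real" and l :: ereal
  assumes "k\<^sub>0 > 0" and "k\<^sub>1 > 0"
    and "\<rho>\<^sub>0 \<in> borel_measurable (lebesgue_on {0..1})"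
    and "\<forall>R\<in>{0..1}. k\<^sub>0 \<le> \<rho>\<^sub>0 R \<and> \<rho>\<^sub>0 R \<le> k\<^sub>1"
    and "\<Phi> = stored_energy \<alpha> \<beta> \<gamma> \<phi> \<psi> h"
    and "smooth_on_unit \<alpha>" and "\<forall>R\<in>{0..1}. \<alpha> R > 0"
    and "smooth_on_unit \<beta>" and "\<forall>R\<in>{0..1}. \<beta> R > 0"
    and "smooth_on_unit \<gamma>" and "\<forall>R\<in>{0..1}. \<gamma> R > 0"
    and "convex_on {0<..} \<phi>" and "\<forall>v>0. \<phi> v \<ge> 0"
    and "convex_on {0<..} \<psi>" and "\<forall>v>0. \<psi> v \<ge> 0"
    and "strictly_convex_on {0<..} h"
    and "energy_growth \<Phi>"
    and "critical_displacement \<Phi> lam\<^sub>c"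
    and "lam > 0"
    and "r \<in> admissible \<Phi> lam" and "r 0 = 0"
    and "has_weak_deriv r dr"
    and "((\<lambda>R. ereal (dr R)) \<longlongrightarrow> l) (at_right 0)" and "0 < l"
    and "ereal lam\<^sub>c < l"
  shows "\<not> is_arg_min (I_total \<rho>\<^sub>0 \<Phi>) (\<lambda>s. s \<in> admissible \<Phi> lam) r"
proof -
  note \<Phi> = assms(5) and lim = assms(23)
  interpret E: radial_energy \<alpha> \<beta> \<gamma> \<phi> \<psi> h
  proof
    show "energy_growth (stored_energy \<alpha> \<beta> \<gamma> \<phi> \<psi> h)" using assms(17) unfolding \<Phi> .
    show "convex_on {0<..} h" using assms(16) by (rule strictly_convex_on_imp_convex_on)
  qed (use assms(6-15) in \<open>auto intro: smooth_on_unit_continuous\<close>)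
  have \<rho>: "\<forall>R\<in>{0..1}. 0 \<le> \<rho>\<^sub>0 R \<and> \<rho>\<^sub>0 R \<le> k\<^sub>1"
    using assms(1,4) by (meson less_imp_le order_trans)
  \<comment> \<open>The definition of the critical displacement fixes no sign for
    \<open>lam\<^sub>c\<close>; the maximum guarantees a positive \<mu>.\<close>
  have "max 0 (ereal lam\<^sub>c) < l" using assms(24,25) by simp
  then obtain \<mu> where "max 0 (ereal lam\<^sub>c) < ereal \<mu>" "ereal \<mu> < l"
    using ereal_dense2 by blast
  then have \<mu>: "0 < \<mu>" "lam\<^sub>c < \<mu>" "ereal \<mu> < l" by (auto simp: zero_ereal_def)
  obtain g where r: "radial_pair r g" "energy_density \<Phi> r g integrable_on {0..1}"
    by (rule E.admissibleE[folded \<Phi>, OF assms(20)]) (rule that)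
  \<comment> \<open>Two densities of \<open>r\<close> are carried along: \<open>g\<close> is
    positive at every point, \<open>dr\<close> has the limit at the origin.\<close>
  have dr: "primitive_on 0 1 r dr"
    by (rule has_weak_deriv_imp_primitive_on[OF radial_pair_continuous[OF r(1)] assms(22)])
  have "\<forall>\<^sub>F x in at_right 0. ereal \<mu> < ereal (dr x)"
    using lim \<mu>(3) by (rule order_tendstoD(1))
  then have "\<forall>\<^sub>F x in at_right 0. \<mu> \<le> dr x"
    by (rule eventually_mono) simp
  then obtain e0 where e0: "e0 > 0" "e0 \<le> 1" "\<And>e. 0 < e \<Longrightarrow> e \<le> e0 \<Longrightarrow> \<mu> \<le> r e / e"
    by (rule slope_eventually_ge[OF dr assms(21)]) (rule that)
  obtain c where c: "c > 0" "\<And>R. 0 < R \<Longrightarrow> R \<le> 1 \<Longrightarrow> c * R \<le> r R"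
    by (rule linear_lower_bound[OF r(1) \<mu>(1) e0]) (assumption | rule that)+
  obtain \<kappa> e1 where \<kappa>: "\<kappa> > 0" "e1 > 0" "\<And>e. 0 < e \<Longrightarrow> e \<le> e1 \<Longrightarrow>
     \<exists>t t'. radial_pair t t' \<and> energy_density \<Phi> t t' integrable_on {0..1} \<and> (\<forall>R\<ge>e. t R = r R) \<and>
       integral {0..1} (energy_density \<Phi> t t') + \<kappa> * e^3 \<le> integral {0..1} (energy_density \<Phi> r g)"
    by (rule E.competitor_supercritical[folded \<Phi>, OF assms(18) \<mu> r assms(21) dr lim]) (rule that)
  define K where "K = 4 * pi * k\<^sub>1\<^sup>2 / c"
  have K: "K \<ge> 0" using c by (simp add: K_def)
  \<comment> \<open>The last two bounds give \<open>K * e^2 <= K * e < \<kappa>\<close>, so the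
    potential loss \<open>K * e^5\<close> stays below the mechanical gain
    \<open>\<kappa> * e^3\<close>.\<close>
  define e where "e = min e1 (min 1 (\<kappa> / (K + 1)))"
  have e: "0 < e" "e \<le> 1" "e \<le> e1" using \<kappa> K by (auto simp: e_def)
  have "e * (K + 1) \<le> \<kappa>"
  proof -
    have "e \<le> \<kappa> / (K + 1)" by (simp add: e_def)
    then show ?thesis using K by (simp add: pos_le_divide_eq)
  qed
  then have "K * e < \<kappa>" using e by (simp add: algebra_simps)
  moreover have "K * e^2 \<le> K * e"
    using K e by (intro mult_left_mono) (auto simp: power2_eq_square mult_le_one mult_left_le)
  ultimately have "K * e^2 * e^3 < \<kappa> * e^3" using e by (intro mult_strict_right_mono) auto
  then have small: "K * e^5 < \<kappa> * e^3" by (simp add: power_numeral_reduce mult.assoc)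
  obtain t t' where t: "radial_pair t t'" "energy_density \<Phi> t t' integrable_on {0..1}" "\<forall>R\<ge>e. t R = r R"
    "integral {0..1} (energy_density \<Phi> t t') + \<kappa> * e^3 \<le> integral {0..1} (energy_density \<Phi> r g)"
    using \<kappa>(3)[OF e(1,3)] by (elim exE conjE) (rule that)
  have "t 1 = lam" using t(3) e(2) assms(20) by (simp add: admissible_def)
  then have adm: "t \<in> admissible \<Phi> lam"
    using E.admissibleI[folded \<Phi>, OF t(1,2)] by simp
  have "I_total \<rho>\<^sub>0 \<Phi> t < I_total \<rho>\<^sub>0 \<Phi> r"
  proof (rule I_total_less)
    show "I_mec \<Phi> r = ennreal (integral {0..1} (energy_density \<Phi> r g))"
      by (rule E.I_mec_eq_integral[folded \<Phi>, OF r])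
    show "I_mec \<Phi> t = ennreal (integral {0..1} (energy_density \<Phi> t t'))"
      by (rule E.I_mec_eq_integral[folded \<Phi>, OF t(1,2)])
    show "0 \<le> integral {0..1} (energy_density \<Phi> r g)"
      by (rule integral_nonneg[OF r(2)]) (rule E.energy_density_nonneg[folded \<Phi>, OF r(1)])
    show "0 \<le> integral {0..1} (energy_density \<Phi> t t')"
      by (rule integral_nonneg[OF t(2)]) (rule E.energy_density_nonneg[folded \<Phi>, OF t(1)])
    show "I_pot \<rho>\<^sub>0 r < \<infinity>" by (rule I_pot_finite[OF assms(3) \<rho> c])
    show "I_pot \<rho>\<^sub>0 r \<le> I_pot \<rho>\<^sub>0 t + ennreal (K * e^5)"
      unfolding K_def
      by (rule I_pot_local_change[OF assms(3) \<rho> c radial_pair_continuous[OF t(1)] e(1,2)]) (use t(3) in auto)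
    show "0 \<le> K * e^5" using K e by simp
    show "integral {0..1} (energy_density \<Phi> t t') + K * e^5 < integral {0..1} (energy_density \<Phi> r g)"
      using t(4) small by simp
  qed
  then show ?thesis using adm by (auto simp: is_arg_min_def)
qed

end
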